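(* Let $W$ be one of $S_n$ ($n\ge1$), $S^B_n$ ($n\ge1$), $\widetilde{S}_n$ ($n\ge3$), $\widetilde{S}^C_n$ ($n\ge2$), with window size $n$. If $w\in W$ globally contains the pattern $321$, then some reduced word for $w$ contains a consecutive triple of letters $x\,(x+1)\,x$ or $x\,(x-1)\,x$ for some $x\in[n-1]$.
   Context: - $S_n$: permutations of $[n]$; unfrozen integers $[n]$. - $S^B_n$: bijections $w$ of $\{-n,\dots,n\}$ with $w(-i)=-w(i)$; unfrozen integers $\{\pm1,\dots,\pm n\}$. - $\widetilde{S}_n$: bijections $w$ of $\mathbb{Z}$ with $w(i+n)=w(i)+n$ and $\sum_{i=1}^n w(i)=\binom{n+1}{2}$; unfrozen integers $\mathbb{Z}$. - $\widetilde{S}^C_n$: bijections $w$ of $\mathbb{Z}$ with $w(-i)=-w(i)$ and $w(2(n+1)-i)=2(n+1)-w(i)$; unfrozen integers $\mathbb{Z}\setminus(n+1)\mathbb{Z}$. Generators (each transposition extended by the group's symmetries): $s_i$ swaps $i,i+1$ for $1\le i\le n-1$; in $\widetilde{S}_n$, $s_0=s_n$ swaps $0,1$ (letters $0$ and $n$ denote the same generator); in $S^B_n$ and $\widetilde{S}^C_n$, $s_0$ swaps $-1,1$; in $\widetilde{S}^C_n$, $s_n$ swaps $n,n+2$. A reduced word for $w$ is a word $i_1\cdots i_\ell$ with $w=s_{i_1}\cdots s_{i_\ell}$ and $\ell$ minimal. $w$ globally contains $321$ if there are unfrozen integers $i<j<k$ with $w(i)>w(j)>w(k)$. *)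

theory Defs
  imports
    Complex_Main
    "HOL-Combinatorics.Permutations"
    "HOL-Library.Sublist"
begin

text \<open>
  Elements of all four groups are maps on the integers, so elements of the two finite
  groups, \<open>Sym\<close> (the symmetric group) and \<open>SymB\<close> (signed permutations), fix every integer
  outside their domain.  \<open>AffSym\<close> and \<open>AffSymC\<close> are their affine counterparts.
\<close>

datatype family = Sym | SymB | AffSym | AffSymC

fun min_window :: "family \<Rightarrow> nat" where
  "min_window Sym = 1"
| "min_window SymB = 1"
| "min_window AffSym = 3"
| "min_window AffSymC = 2"

fun perm_group :: "family \<Rightarrow> nat \<Rightarrow> (int \<Rightarrow> int) set" where
  "perm_group Sym n = {w. w permutes {1..int n}}"
| "perm_group SymB n =
     {w. w permutes {- int n..int n} \<and> (\<forall>i\<in>{- int n..int n}. w (- i) = - w i)}"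
| "perm_group AffSym n =
     {w. bij w \<and> (\<forall>i. w (i + int n) = w i + int n) \<and>
         (\<Sum>i = 1..int n. w i) = int ((n + 1) choose 2)}"
| "perm_group AffSymC n =
     {w. bij w \<and> (\<forall>i. w (- i) = - w i) \<and>
         (\<forall>i. w (2 * (int n + 1) - i) = 2 * (int n + 1) - w i)}"

fun unfrozen :: "family \<Rightarrow> nat \<Rightarrow> int set" where
  "unfrozen Sym n = {1..int n}"
| "unfrozen SymB n = {- int n..int n} - {0}"
| "unfrozen AffSym n = UNIV"
| "unfrozen AffSymC n = {i. \<not> (int n + 1) dvd i}"

definition globally_contains_321 :: "family \<Rightarrow> nat \<Rightarrow> (int \<Rightarrow> int) \<Rightarrow> bool" where
  "globally_contains_321 F n w \<longleftrightarrow>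
     (\<exists>i\<in>unfrozen F n. \<exists>j\<in>unfrozen F n. \<exists>k\<in>unfrozen F n.
        i < j \<and> j < k \<and> w i > w j \<and> w j > w k)"

text \<open>
  The product of the transpositions of \<open>a + m * N\<close> and \<open>b + m * N\<close> over all integers \<open>m\<close>;
  meant for \<open>a\<close> and \<open>b\<close> that are incongruent modulo \<open>N\<close>.
\<close>

definition periodic_swap :: "int \<Rightarrow> int \<Rightarrow> int \<Rightarrow> int \<Rightarrow> int" where
  "periodic_swap N a b j =
     (if N dvd j - a then j + (b - a) else if N dvd j - b then j - (b - a) else j)"

text \<open>
  For \<open>AffSym\<close>, the letters \<open>0\<close> and \<open>n\<close> denote the same generator and may be used
  interchangeably in words.
\<close>

fun letters :: "family \<Rightarrow> nat \<Rightarrow> nat set" where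
  "letters Sym n = {1..<n}"
| "letters SymB n = {0..<n}"
| "letters AffSym n = {0..n}"
| "letters AffSymC n = {0..n}"

text \<open>
  The two symmetries \<open>i \<mapsto> - i\<close> and \<open>i \<mapsto> 2 * (n + 1) - i\<close> of \<open>AffSymC\<close> generate the
  translation by \<open>2 * (n + 1)\<close>, whence the period of its generators.
\<close>

fun gen :: "family \<Rightarrow> nat \<Rightarrow> nat \<Rightarrow> int \<Rightarrow> int" where
  "gen Sym n i = transpose (int i) (int i + 1)"
| "gen SymB n i =
     (if i = 0 then transpose (- 1) 1
      else transpose (int i) (int i + 1) \<circ> transpose (- int i) (- (int i + 1)))"
| "gen AffSym n i = periodic_swap (int n) (int i) (int i + 1)"
| "gen AffSymC n i =
     (let N = 2 * (int n + 1) in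
      if i = 0 then periodic_swap N (- 1) 1
      else if i = n then periodic_swap N (int n) (int n + 2)
      else periodic_swap N (int i) (int i + 1) \<circ>
           periodic_swap N (- int i) (- (int i + 1)))"

definition word_prod :: "family \<Rightarrow> nat \<Rightarrow> nat list \<Rightarrow> int \<Rightarrow> int" where
  "word_prod F n xs = foldr (\<lambda>i w. gen F n i \<circ> w) xs id"

definition word_for :: "family \<Rightarrow> nat \<Rightarrow> (int \<Rightarrow> int) \<Rightarrow> nat list \<Rightarrow> bool" where
  "word_for F n w xs \<longleftrightarrow> set xs \<subseteq> letters F n \<and> word_prod F n xs = w"

definition reduced_word :: "family \<Rightarrow> nat \<Rightarrow> (int \<Rightarrow> int) \<Rightarrow> nat list \<Rightarrow> bool" where
  "reduced_word F n w xs \<longleftrightarrow>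
     word_for F n w xs \<and> (\<forall>ys. word_for F n w ys \<longrightarrow> length xs \<le> length ys)"

end

theory Submission
  imports Defs
begin

text \<open>
  Take a \<open>321\<close> pattern of \<open>w\<close> in the positions \<open>i < j < k\<close>. If \<open>i\<close> and \<open>j\<close> are not adjacent, let
  \<open>q\<close> be the position after \<open>i\<close>: either \<open>q, j, k\<close> is again a \<open>321\<close> pattern, or \<open>w\<close> has a
  descent at \<open>i, q\<close>, and the generator \<open>s\<close> of that descent shortens \<open>w\<close> to \<open>w \<circ> s\<close> and moves the
  pattern closer together; likewise at \<open>k\<close>. Appending \<open>s\<close> to a reduced word of \<open>w \<circ> s\<close>
  gives one of \<open>w\<close>, so the pattern may be assumed to be consecutive, and then \<open>w\<close> has a reduced
  word that ends in the required triple. In the types with reflections there is one exception, a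
  \<open>4231\<close> pattern symmetric about a frozen point, which shrinks until only that point separates
  its two middle positions and then gives a triple such as \<open>1 0 1\<close>.

  The length is never counted: that a word can be shortened at a descent is the exchange property,
  and that every element has a word follows from the sum of \<open>(w x - x)\<^sup>2\<close> over a window, which
  decreases at descents.
\<close>

section \<open>Consecutive elements of a set of integers, and symmetries of the integers\<close>

definition neighbours :: "int set \<Rightarrow> int \<Rightarrow> int \<Rightarrow> bool" where
  "neighbours U x y \<longleftrightarrow> x \<in> U \<and> y \<in> U \<and> x < y \<and> (\<forall>z\<in>U. \<not> (x < z \<and> z < y))"

text \<open>Each group supplies its successor function through this lemma. The second hypothesis
  makes \<open>f x\<close> the least element of \<open>U\<close> above \<open>x\<close>, but only
  when there is one, so the last element of a finite \<open>U\<close> needs no successor.\<close>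

lemma neighbours_iff_next:
  assumes "\<And>x. x \<in> U \<Longrightarrow> x < f x" "\<And>x y. x \<in> U \<Longrightarrow> y \<in> U \<Longrightarrow> x < y \<Longrightarrow> f x \<in> U \<and> f x \<le> y"
  shows "neighbours U x y \<longleftrightarrow> x \<in> U \<and> y \<in> U \<and> y = f x"
proof
  assume "neighbours U x y"
  then have "x \<in> U" "y \<in> U" "x < y" "\<And>z. z \<in> U \<Longrightarrow> x < z \<Longrightarrow> y \<le> z"
    by (auto simp: neighbours_def)
  then show "x \<in> U \<and> y \<in> U \<and> y = f x" using assms by (metis order_antisym)
next
  assume *: "x \<in> U \<and> y \<in> U \<and> y = f x"
  have "y \<le> z" if "z \<in> U" "x < z" for z using assms(2)[of x z] * that by blast
  then show "neighbours U x y" using * assms(1)[of x] by (fastforce simp: neighbours_def)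
qed

lemma neighbours_next:
  assumes "x \<in> U" "y \<in> U" "x < y"
  obtains z where "neighbours U x z" "z \<le> y"
proof -
  define B where "B = {z \<in> U. x < z \<and> z \<le> y}"
  have "B \<subseteq> {x..y}" by (auto simp: B_def)
  then have fin: "finite B" by (rule finite_subset) simp
  have "y \<in> B" using assms by (simp add: B_def)
  then obtain m where m: "m \<in> B" "\<And>z. z \<in> B \<Longrightarrow> m \<le> z"
    using fin Min_in[of B] Min_le[of B] by blast
  have "\<not> (x < z \<and> z < m)" if "z \<in> U" for z
    using m(1) m(2)[of z] that by (auto simp: B_def)
  then have "neighbours U x m" using m(1) assms by (simp add: B_def neighbours_def)
  then show thesis using that m(1) by (simp add: B_def)
qed

lemma neighbours_previous:
  assumes "x \<in> U" "y \<in> U" "x < y"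
  obtains z where "neighbours U z y" "x \<le> z"
proof -
  define B where "B = {z \<in> U. x \<le> z \<and> z < y}"
  have "B \<subseteq> {x..y}" by (auto simp: B_def)
  then have fin: "finite B" by (rule finite_subset) simp
  have "x \<in> B" using assms by (simp add: B_def)
  then obtain m where m: "m \<in> B" "\<And>z. z \<in> B \<Longrightarrow> z \<le> m"
    using fin Max_in[of B] Max_ge[of B] by blast
  have "\<not> (m < z \<and> z < y)" if "z \<in> U" for z
    using m(1) m(2)[of z] that by (auto simp: B_def)
  then have "neighbours U m y" using m(1) assms by (simp add: B_def neighbours_def)
  then show thesis using that m(1) by (simp add: B_def)
qed

text \<open>With \<open>N = 0\<close> these are the identity and, if \<open>r\<close> holds,
  negation, so that the finite groups are covered by the same definition as the affine ones.\<close>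

definition symmetries :: "int \<Rightarrow> bool \<Rightarrow> (int \<Rightarrow> int) set" where
  "symmetries N r = {f. \<exists>c. N dvd c \<and> (f = (\<lambda>x. x + c) \<or> r \<and> f = (\<lambda>x. c - x))}"

lemma symmetries_cases:
  assumes "g \<in> symmetries N r"
  obtains (translation) c where "N dvd c" "g = (\<lambda>x. x + c)"
  | (reflection) c where "r" "N dvd c" "g = (\<lambda>x. c - x)"
  using assms by (auto simp: symmetries_def)

lemma symmetries_translation: "N dvd c \<Longrightarrow> (\<lambda>x. x + c) \<in> symmetries N r"
  and symmetries_reflection: "N dvd c \<Longrightarrow> r \<Longrightarrow> (\<lambda>x. c - x) \<in> symmetries N r"
  by (auto simp: symmetries_def)

lemma symmetries_inj: "g \<in> symmetries N r \<Longrightarrow> g x = g y \<longleftrightarrow> x = y"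
  by (auto simp: symmetries_def)

text \<open>The symmetries form a group, and \<open>f\<close> is \<open>g\<close> composed with the
  inverse of \<open>h\<close>.\<close>

lemma symmetries_quotient:
  assumes "g \<in> symmetries N r" "h \<in> symmetries N r"
  shows "\<exists>f\<in>symmetries N r. \<forall>x. f (h x) = g x"
  using assms(1)
proof (cases rule: symmetries_cases)
  case g: (translation c)
  from assms(2) show ?thesis
  proof (cases rule: symmetries_cases)
    case (translation d)
    then show ?thesis
      by (intro bexI[of _ "\<lambda>x. x + (c - d)"] symmetries_translation) (auto simp: g)
  next
    case (reflection d)
    then show ?thesis
      by (intro bexI[of _ "\<lambda>x. (d + c) - x"] symmetries_reflection) (auto simp: g)
  qed
next
  case g: (reflection c)
  from assms(2) show ?thesis
  proof (cases rule: symmetries_cases)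
    case (translation d)
    then show ?thesis
      by (intro bexI[of _ "\<lambda>x. (c + d) - x"] symmetries_reflection) (auto simp: g)
  next
    case (reflection d)
    then show ?thesis
      by (intro bexI[of _ "\<lambda>x. x + (c - d)"] symmetries_translation) (auto simp: g)
  qed
qed

text \<open>The relation is not symmetric: \<open>x\<close> is the letter that is to occur twice and
  must lie in \<open>[n - 1]\<close>, whereas \<open>y\<close> may also be \<open>0\<close> or
  \<open>n\<close>.\<close>

definition braid_letters :: "nat \<Rightarrow> nat \<Rightarrow> nat \<Rightarrow> bool" where
  "braid_letters n x y \<longleftrightarrow> x \<in> {1..n - 1} \<and> (y = x + 1 \<or> y = x - 1)"

lemma word_prod_Nil [simp]: "word_prod F n [] = id"
  and word_prod_Cons [simp]: "word_prod F n (a # xs) = gen F n a \<circ> word_prod F n xs"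
  by (simp_all add: word_prod_def)

lemma word_prod_append [simp]:
  "word_prod F n (xs @ ys) = word_prod F n xs \<circ> word_prod F n ys"
  by (induction xs) (auto simp: fun_eq_iff)

section \<open>Groups generated by exchanges of neighbours\<close>

text \<open>The common properties of the four groups. The letter \<open>a\<close> exchanges
  \<open>lo a\<close> with \<open>hi a\<close> and all symmetric images of this pair; sums over the
  window \<open>A\<close> of symmetric functions may be reindexed by a generator. In
  \<open>braid3\<close> the two letters are chosen together, because a generator can have two
  letters whose numbers are not equally suitable. In \<open>braid4\<close> a single generator
  exchanges two pairs that are one gap apart, which happens only around a frozen point.\<close>

locale window_group =
  fixes F :: family and n :: nat
    and N :: int and r :: bool and A :: "int set" and lo hi :: "nat \<Rightarrow> int"
  assumes unfrozen_symmetry: "g \<in> symmetries N r \<Longrightarrow> x \<in> unfrozen F n \<Longrightarrow> g x \<in> unfrozen F n"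
    and group_symmetry: "w \<in> perm_group F n \<Longrightarrow> g \<in> symmetries N r \<Longrightarrow> w (g x) = g (w x)"
    and group_inj: "w \<in> perm_group F n \<Longrightarrow> w x = w y \<Longrightarrow> x = y"
    and group_unfrozen: "w \<in> perm_group F n \<Longrightarrow> x \<in> unfrozen F n \<Longrightarrow> w x \<in> unfrozen F n"
    and group_id: "id \<in> perm_group F n"
    and group_gen: "w \<in> perm_group F n \<Longrightarrow> a \<in> letters F n \<Longrightarrow> w \<circ> gen F n a \<in> perm_group F n"
    and lo_hi: "a \<in> letters F n \<Longrightarrow> neighbours (unfrozen F n) (lo a) (hi a)"
    and gen_lo: "a \<in> letters F n \<Longrightarrow> gen F n a (lo a) = hi a"
    and gen_hi: "a \<in> letters F n \<Longrightarrow> gen F n a (hi a) = lo a"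
    and gen_moved: "a \<in> letters F n \<Longrightarrow> gen F n a x \<noteq> x \<Longrightarrow>
      \<exists>g\<in>symmetries N r. x = g (lo a) \<or> x = g (hi a)"
    and gen_neighbours: "neighbours (unfrozen F n) x y \<Longrightarrow> \<exists>a\<in>letters F n. gen F n a x = y"
    and braid3: "neighbours (unfrozen F n) x y \<Longrightarrow> neighbours (unfrozen F n) y z \<Longrightarrow>
      \<exists>a\<in>letters F n. \<exists>b\<in>letters F n. gen F n a x = y \<and> gen F n b y = z \<and>
        (braid_letters n a b \<or> braid_letters n b a)"
    and braid4: "neighbours (unfrozen F n) x y \<Longrightarrow> neighbours (unfrozen F n) y z \<Longrightarrow>
      neighbours (unfrozen F n) z t \<Longrightarrow> c \<in> letters F n \<Longrightarrow> gen F n c x = y \<Longrightarrow> gen F n c z = t \<Longrightarrow>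
      \<exists>a\<in>letters F n. \<exists>b\<in>letters F n. gen F n a x = y \<and> gen F n b y = z \<and> gen F n a z = t \<and>
        gen F n b x = x \<and> braid_letters n a b"
    and increasing_id: "w \<in> perm_group F n \<Longrightarrow>
      (\<And>x y. neighbours (unfrozen F n) x y \<Longrightarrow> w x < w y) \<Longrightarrow> w = id"
    and window_finite: "finite A"
    and window_cover: "x \<in> unfrozen F n \<Longrightarrow> \<exists>g\<in>symmetries N r. g x \<in> A"
    and window_sum: "a \<in> letters F n \<Longrightarrow>
      (\<And>g x. g \<in> symmetries N r \<Longrightarrow> h (g x) = h x) \<Longrightarrow>
      (\<Sum>x\<in>A. h (gen F n a x)) = (\<Sum>x\<in>A. h x :: int)"
begin

abbreviation "U \<equiv> unfrozen F n"
abbreviation "W \<equiv> perm_group F n"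
abbreviation "L \<equiv> letters F n"
abbreviation "s \<equiv> gen F n"

section \<open>Generators as exchanges of symmetric pairs\<close>

lemma gen_in_group: "a \<in> L \<Longrightarrow> s a \<in> W"
  using group_gen[OF group_id] by simp

lemma word_prod_in_group: "set xs \<subseteq> L \<Longrightarrow> word_prod F n xs \<in> W"
proof (induction xs rule: rev_induct)
  case (snoc a xs)
  then show ?case using group_gen[of "word_prod F n xs" a] by (simp add: comp_def)
qed (simp add: group_id)

lemma gen_symmetry: "a \<in> L \<Longrightarrow> g \<in> symmetries N r \<Longrightarrow> s a (g x) = g (s a x)"
  using group_symmetry gen_in_group by blast

lemma gen_moved_cases:
  assumes "a \<in> L" "s a x \<noteq> x"
  obtains g where "g \<in> symmetries N r" "x = g (lo a)" "s a x = g (hi a)"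
  | g where "g \<in> symmetries N r" "x = g (hi a)" "s a x = g (lo a)"
proof -
  obtain g where "g \<in> symmetries N r" "x = g (lo a) \<or> x = g (hi a)" using gen_moved[OF assms] by blast
  then show thesis
    using that gen_symmetry[OF assms(1)] gen_lo[OF assms(1)] gen_hi[OF assms(1)] by auto
qed

lemma gen_invol [simp]:
  assumes "a \<in> L"
  shows "s a (s a x) = x"
proof (cases "s a x = x")
  case False
  with assms show ?thesis
    by (cases rule: gen_moved_cases)
      (simp_all add: gen_symmetry[OF assms] gen_lo[OF assms] gen_hi[OF assms])
qed simp

lemma gen_comp_gen: "a \<in> L \<Longrightarrow> w \<circ> s a \<circ> s a = w"
  by (simp add: fun_eq_iff)

lemma gen_unfrozen: "a \<in> L \<Longrightarrow> x \<in> U \<Longrightarrow> s a x \<in> U"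
  using group_unfrozen gen_in_group by blast

lemma neighbours_symmetry:
  assumes "neighbours U x y" "g \<in> symmetries N r"
  shows "neighbours U (g x) (g y) \<or> neighbours U (g y) (g x)"
proof -
  \<comment> \<open>\<open>f\<close> is the inverse of \<open>g\<close>, obtained as the quotient of
    the identity by \<open>g\<close>.\<close>
  obtain f where f: "f \<in> symmetries N r" "\<And>x. f (g x) = x"
    using symmetries_quotient[OF symmetries_translation[of N 0 r] assms(2)] by auto
  have U: "g x \<in> U" "g y \<in> U" using assms unfrozen_symmetry by (auto simp: neighbours_def)
  from assms(2) show ?thesis
  proof (cases rule: symmetries_cases)
    case (translation c)
    have "\<not> (g x < z \<and> z < g y)" if "z \<in> U" for z
    proof -
      have "f z = z - c" using f(2)[of "z - c"] by (simp add: translation)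
      then show ?thesis using unfrozen_symmetry[OF f(1) that] assms(1)
        by (auto simp: neighbours_def translation)
    qed
    then show ?thesis using U assms(1) by (auto simp: neighbours_def translation)
  next
    case (reflection c)
    have "\<not> (g y < z \<and> z < g x)" if "z \<in> U" for z
    proof -
      have "f z = c - z" using f(2)[of "c - z"] by (simp add: reflection)
      then show ?thesis using unfrozen_symmetry[OF f(1) that] assms(1)
        by (auto simp: neighbours_def reflection)
    qed
    then show ?thesis using U assms(1) by (auto simp: neighbours_def reflection)
  qed
qed

lemma moved_neighbours:
  assumes "a \<in> L" "s a x \<noteq> x"
  shows "neighbours U x (s a x) \<or> neighbours U (s a x) x"
  using assms
  by (cases rule: gen_moved_cases) (use neighbours_symmetry[OF lo_hi[OF assms(1)]] in auto)

lemma moved_unfrozen: "a \<in> L \<Longrightarrow> s a x \<noteq> x \<Longrightarrow> x \<in> U"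
  using moved_neighbours by (auto simp: neighbours_def)

text \<open>A generator moves a point at most to the next or previous unfrozen point, which leaves
  no room for two points to cross unless they change places.\<close>

lemma gen_inversion:
  assumes "a \<in> L" "x \<in> U" "y \<in> U" "x < y" "s a y < s a x"
  shows "s a x = y"
proof (rule ccontr)
  assume neq: "s a x \<noteq> y"
  have nx: "s a x = x \<or> neighbours U x (s a x) \<or> neighbours U (s a x) x"
    and ny: "s a y = y \<or> neighbours U y (s a y) \<or> neighbours U (s a y) y"
    using moved_neighbours[OF assms(1)] by blast+
  show False
  proof (cases "x < s a x")
    case True
    then have "s a x < y" using nx neq assms(3,4) by (auto simp: neighbours_def)
    then show False using ny gen_unfrozen[OF assms(1,2)] assms(5) by (auto simp: neighbours_def)
  next
    case False
    then show False using ny assms(2,4,5) by (auto simp: neighbours_def)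
  qed
qed

text \<open>All moved points lie in symmetric images of one pair, so statements about every moved
  pair reduce to a single one. When both pairs are listed in increasing order, \<open>g\<close> is a
  translation in the case \<open>same\<close> and a reflection in the case
  \<open>swapped\<close>.\<close>

lemma moved_symmetric:
  assumes "a \<in> L" "s a x \<noteq> x" "s a y \<noteq> y"
  obtains (same) g where "g \<in> symmetries N r" "y = g x" "s a y = g (s a x)"
  | (swapped) g where "g \<in> symmetries N r" "y = g (s a x)" "s a y = g x"
proof -
  note result = that
  have thesis if f: "f \<in> symmetries N r" "y = f (lo a) \<and> s a y = f (hi a) \<or> y = f (hi a) \<and> s a y = f (lo a)"
    and h: "h \<in> symmetries N r" "x = h (lo a) \<and> s a x = h (hi a) \<or> x = h (hi a) \<and> s a x = h (lo a)" for f h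
  proof -
    obtain g where "g \<in> symmetries N r" "\<And>z. g (h z) = f z"
      using symmetries_quotient[OF f(1) h(1)] by blast
    then show thesis using result[of g] f(2) h(2) by auto
  qed
  moreover obtain h where "h \<in> symmetries N r"
    "x = h (lo a) \<and> s a x = h (hi a) \<or> x = h (hi a) \<and> s a x = h (lo a)"
    using assms(1,2) by (rule gen_moved_cases) blast+
  moreover obtain f where "f \<in> symmetries N r"
    "y = f (lo a) \<and> s a y = f (hi a) \<or> y = f (hi a) \<and> s a y = f (lo a)"
    using assms(1,3) by (rule gen_moved_cases) blast+
  ultimately show thesis by blast
qed

text \<open>The conjugate of \<open>s a\<close> by \<open>u\<close> and the generator
  \<open>s b\<close> both exchange the symmetric images of one pair, since \<open>u\<close> commutes
  with the symmetries. Hence agreement at one moved point suffices.\<close>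

lemma conjugate_gen:
  assumes "u \<in> W" "a \<in> L" "b \<in> L" "s a x \<noteq> x" "s b (u x) = u (s a x)"
  shows "u \<circ> s a = s b \<circ> u"
proof
  fix y
  have ux: "s b (u x) \<noteq> u x" using assms group_inj by metis
  show "(u \<circ> s a) y = (s b \<circ> u) y"
  proof (cases "s a y = y")
    case True
    have "s b (u y) = u y"
    proof (rule ccontr)
      assume "s b (u y) \<noteq> u y"
      from assms(3) ux this show False
      proof (cases rule: moved_symmetric)
        case (same g)
        then have "y = g x"
          using group_symmetry[OF assms(1) same(1), of x] group_inj[OF assms(1), of y "g x"] by simp
        then show False
          using True gen_symmetry[OF assms(2) same(1)] symmetries_inj[OF same(1)] assms(4) by simp
      next
        case (swapped g)
        then have "y = g (s a x)"
          using group_symmetry[OF assms(1) swapped(1), of "s a x"]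
            group_inj[OF assms(1), of y "g (s a x)"] assms(5) by simp
        then show False
          using True gen_symmetry[OF assms(2) swapped(1)] symmetries_inj[OF swapped(1)] assms(2,4)
          by simp
      qed
    qed
    then show ?thesis using True by simp
  next
    case False
    from assms(2,4) False show ?thesis
    proof (cases rule: moved_symmetric)
      case (same g)
      then show ?thesis using group_symmetry[OF assms(1)] gen_symmetry[OF assms(3)] assms(5) by simp
    next
      case (swapped g)
      moreover have "s b (u (s a x)) = u x" using gen_invol[OF assms(3), of "u x"] assms(5) by simp
      ultimately show ?thesis
        using group_symmetry[OF assms(1) swapped(1)] gen_symmetry[OF assms(3) swapped(1)] by simp
    qed
  qed
qed

section \<open>Descents and the exchange property\<close>

definition descent :: "(int \<Rightarrow> int) \<Rightarrow> nat \<Rightarrow> bool" where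
  "descent w a \<longleftrightarrow> (\<forall>x. x < s a x \<longrightarrow> w (s a x) < w x)"

text \<open>One pair decides for all: a translation keeps the order of positions and of values, and
  a reflection reverses both.\<close>

lemma descentI:
  assumes "w \<in> W" "a \<in> L" "x < s a x" "w (s a x) < w x"
  shows "descent w a"
  unfolding descent_def
proof (intro allI impI)
  fix y assume y: "y < s a y"
  have "s a x \<noteq> x" "s a y \<noteq> y" using assms(3) y by auto
  with assms(2) show "w (s a y) < w y"
  proof (cases rule: moved_symmetric)
    case (same g)
    from same(1) show ?thesis
      by (cases rule: symmetries_cases)
        (use same y assms group_symmetry[OF assms(1) same(1)] in auto)
  next
    case (swapped g)
    from swapped(1) show ?thesis
      by (cases rule: symmetries_cases)
        (use swapped y assms group_symmetry[OF assms(1) swapped(1)] in auto)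
  qed
qed

lemma descentD: "descent w a \<Longrightarrow> x < s a x \<Longrightarrow> w (s a x) < w x"
  by (simp add: descent_def)

text \<open>A symmetry maps the pair exchanged at \<open>x\<close> to the one exchanged at \<open>y\<close>. If it is a translation,
  then both inequalities are false; if it is a reflection, then it turns one into the other.\<close>

lemma two_pairs_swapped:
  assumes "w \<in> W" "a \<in> L" "x < s a x" "y < s a y" "x < y"
  shows "w y < w x \<longleftrightarrow> w (s a y) < w (s a x)"
proof -
  have "s a x \<noteq> x" "s a y \<noteq> y" using assms(3,4) by auto
  with assms(2) show ?thesis
  proof (cases rule: moved_symmetric)
    case (same g)
    from same(1) show ?thesis
      by (cases rule: symmetries_cases)
        (use same assms group_symmetry[OF assms(1) same(1)] in auto)
  next
    case (swapped g)
    from swapped(1) show ?thesis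
      by (cases rule: symmetries_cases)
        (use swapped assms group_symmetry[OF assms(1) swapped(1)] in auto)
  qed
qed

text \<open>Reading the word from the right, some letter is the one that puts the images of
  \<open>x\<close> and \<open>s b x\<close> in the wrong order. That letter exchanges the two
  images, so by conjugation deleting it has the same effect as multiplying by \<open>s b\<close> on
  the right.\<close>

lemma exchange:
  assumes "set xs \<subseteq> L" "b \<in> L" "x < s b x" "word_prod F n xs (s b x) < word_prod F n xs x"
  shows "\<exists>ys. set ys \<subseteq> L \<and> Suc (length ys) = length xs \<and> word_prod F n ys = word_prod F n xs \<circ> s b"
  using assms(1,4)
proof (induction xs)
  case Nil
  then show ?case using assms(3) by simp
next
  case (Cons a xs)
  define u where "u = word_prod F n xs"
  have u: "u \<in> W" and a: "a \<in> L" using Cons.prems word_prod_in_group by (auto simp: u_def)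
  have x: "x \<in> U" using moved_unfrozen[OF assms(2)] assms(3) by auto
  show ?case
  proof (cases "u (s b x) < u x")
    case True
    then obtain ys where "set ys \<subseteq> L" "Suc (length ys) = length xs" "word_prod F n ys = u \<circ> s b"
      using Cons.IH Cons.prems by (auto simp: u_def simp del: comp_apply)
    then show ?thesis using a by (intro exI[of _ "a # ys"]) (simp add: u_def comp_assoc)
  next
    case False
    have "u x \<noteq> u (s b x)" using group_inj[OF u] assms(3) by (metis less_irrefl)
    then have "u x < u (s b x)" using False by simp
    then have "s a (u x) = u (s b x)"
      using gen_inversion[OF a] Cons.prems(2) group_unfrozen[OF u] x gen_unfrozen[OF assms(2) x]
      by (auto simp: u_def)
    then have "u \<circ> s b = s a \<circ> u" using conjugate_gen[OF u assms(2) a, of x] assms(3) by simp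
    then have "word_prod F n (a # xs) \<circ> s b = u"
      using a by (auto simp: u_def[symmetric] fun_eq_iff)
    then show ?thesis using Cons.prems(1)
      by (intro exI[of _ xs] conjI) (simp_all add: u_def del: comp_apply)
  qed
qed

text \<open>Minimality comes from the exchange property: any word of \<open>w\<close> yields a word
  of \<open>w \<circ> s a\<close> that is one letter shorter.\<close>

lemma reduced_word_snoc:
  assumes "a \<in> L" "x < s a x" "w (s a x) < w x" "reduced_word F n (w \<circ> s a) xs"
  shows "reduced_word F n w (xs @ [a])"
  unfolding reduced_word_def
proof (intro conjI allI impI)
  have xs: "set xs \<subseteq> L" "word_prod F n xs = w \<circ> s a"
    and min: "\<And>ys. word_for F n (w \<circ> s a) ys \<Longrightarrow> length xs \<le> length ys"
    using assms(4) by (auto simp: reduced_word_def word_for_def)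
  show "word_for F n w (xs @ [a])"
    using xs assms(1) gen_comp_gen[OF assms(1)] by (simp add: word_for_def)
  fix ys assume "word_for F n w ys"
  then have ys: "set ys \<subseteq> L" "word_prod F n ys = w" by (auto simp: word_for_def)
  then obtain zs where "set zs \<subseteq> L" "Suc (length zs) = length ys" "word_prod F n zs = w \<circ> s a"
    using exchange[of ys a x] assms by auto
  then show "length (xs @ [a]) \<le> length ys" using min[of zs] by (simp add: word_for_def)
qed

section \<open>Existence of reduced words\<close>

definition displacement :: "(int \<Rightarrow> int) \<Rightarrow> int" where
  "displacement w = (\<Sum>x\<in>A. (w x - x)\<^sup>2)"

lemma symmetry_diff_square:
  assumes "g \<in> symmetries N r"
  shows "(g x - g y)\<^sup>2 = (x - y)\<^sup>2"
  using assms by (cases rule: symmetries_cases) (auto simp: power2_commute)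

text \<open>A rearrangement argument: twice the difference is the sum of the terms
  \<open>2 * t y\<close>, and at a descent \<open>t y\<close> is positive at each moved
  \<open>y\<close> and zero elsewhere.\<close>

lemma displacement_descent:
  assumes "w \<in> W" "a \<in> L" "x < s a x" "w (s a x) < w x"
  shows "displacement (w \<circ> s a) < displacement w"
proof -
  define t where "t y = (s a y - y) * (w y - w (s a y))" for y
  have d: "descent w a" using descentI[OF assms] .
  have "s a (s a y) = y" for y using assms(2) by simp
  then have pos: "s a y \<noteq> y \<Longrightarrow> 0 < t y" for y
    using descentD[OF d, of y] descentD[OF d, of "s a y"]
    by (cases "y < s a y") (auto simp: t_def intro: mult_pos_pos mult_neg_neg)
  have nonneg: "0 \<le> t y" for y using pos[of y] by (cases "s a y = y") (auto simp: t_def)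
  \<comment> \<open>At least one moved point lies in the window, which makes the sum of the
    \<open>t y\<close> strictly positive.\<close>
  obtain g where g: "g \<in> symmetries N r" "g x \<in> A"
    using window_cover moved_unfrozen[OF assms(2), of x] assms(3) by auto
  have "s a (g x) \<noteq> g x"
    using gen_symmetry[OF assms(2) g(1)] symmetry_diff_square[OF g(1), of "s a x" x] assms(3) by auto
  then have tpos: "0 < (\<Sum>y\<in>A. t y)"
    using sum_pos2[OF window_finite g(2), of t] pos nonneg by blast
  \<comment> \<open>The window need not be stable under \<open>s a\<close>, so each displacement is
    written twice, once with \<open>y\<close> and once with \<open>s a y\<close>, before the terms
    are compared.\<close>
  have inv1: "(\<Sum>y\<in>A. (w (s a y) - s a y)\<^sup>2) = (\<Sum>y\<in>A. (w y - y)\<^sup>2)"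
    by (rule window_sum[OF assms(2)])
      (use group_symmetry[OF assms(1)] symmetry_diff_square in simp)
  have inv2: "(\<Sum>y\<in>A. (w (s a (s a y)) - s a y)\<^sup>2) = (\<Sum>y\<in>A. (w (s a y) - y)\<^sup>2)"
    by (rule window_sum[OF assms(2)])
      (use group_symmetry[OF group_gen[OF assms(1,2)]] symmetry_diff_square in simp)
  have "2 * displacement w - 2 * displacement (w \<circ> s a)
      = (\<Sum>y\<in>A. (w y - y)\<^sup>2) + (\<Sum>y\<in>A. (w (s a y) - s a y)\<^sup>2)
        - (\<Sum>y\<in>A. (w (s a y) - y)\<^sup>2) - (\<Sum>y\<in>A. (w y - s a y)\<^sup>2)"
    using inv1 inv2 assms(2) by (simp add: displacement_def)
  also have "\<dots> = (\<Sum>y\<in>A. 2 * t y)"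
    unfolding sum.distrib[symmetric] sum_subtractf[symmetric]
    by (rule sum.cong) (auto simp: t_def power2_eq_square algebra_simps)
  finally show ?thesis using tpos by (simp add: sum_distrib_left[symmetric])
qed

lemma word_exists: "w \<in> W \<Longrightarrow> \<exists>xs. word_for F n w xs"
proof (induction "nat (displacement w)" arbitrary: w rule: less_induct)
  case less
  show ?case
  proof (cases "\<forall>x y. neighbours U x y \<longrightarrow> w x < w y")
    case True
    then show ?thesis using increasing_id[OF less.prems]
      by (intro exI[of _ "[]"]) (auto simp: word_for_def)
  next
    case False
    then obtain x y where xy: "neighbours U x y" "\<not> w x < w y" by auto
    then obtain a where a: "a \<in> L" "s a x = y" using gen_neighbours by auto
    have x: "x < s a x" using xy a by (auto simp: neighbours_def)
    then have "w (s a x) < w x" using xy(2) a(2) group_inj[OF less.prems, of x "s a x"] by force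
    note desc = displacement_descent[OF less.prems a(1) x this]
    have "0 \<le> displacement (w \<circ> s a)" by (simp add: displacement_def sum_nonneg)
    then obtain xs where "word_for F n (w \<circ> s a) xs"
      using less.hyps[of "w \<circ> s a"] desc group_gen[OF less.prems a(1)] by auto
    then show ?thesis using a(1) gen_comp_gen[OF a(1)]
      by (intro exI[of _ "xs @ [a]"]) (simp add: word_for_def)
  qed
qed

lemma reduced_word_exists: "w \<in> W \<Longrightarrow> \<exists>xs. reduced_word F n w xs"
  using word_exists ex_has_least_nat[of "word_for F n w" _ length]
  unfolding reduced_word_def by blast

section \<open>Braid triples at the end of reduced words\<close>

definition has_braid :: "(int \<Rightarrow> int) \<Rightarrow> bool" where
  "has_braid w \<longleftrightarrow> (\<exists>xs x y. reduced_word F n w xs \<and> braid_letters n x y \<and> sublist [x, y, x] xs)"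

lemma has_braid_step:
  assumes "a \<in> L" "x < s a x" "w (s a x) < w x" "has_braid (w \<circ> s a)"
  shows "has_braid w"
proof -
  obtain xs y z where "reduced_word F n (w \<circ> s a) xs" "braid_letters n y z" "sublist [y, z, y] xs"
    using assms(4) by (auto simp: has_braid_def)
  then show ?thesis using reduced_word_snoc[OF assms(1-3)]
    unfolding has_braid_def by (metis sublist_order.order.trans sublist_append_rightI)
qed

text \<open>The last six hypotheses say that \<open>a\<close>, \<open>b\<close>, \<open>a\<close>
  are descents of \<open>w\<close>, \<open>w \<circ> s a\<close> and
  \<open>w \<circ> s a \<circ> s b\<close> in turn, so a reduced word of
  \<open>w \<circ> s a \<circ> s b \<circ> s a\<close> extends by these letters to one of
  \<open>w\<close>.\<close>

lemma has_braid_three_descents: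
  assumes "w \<in> W" "a \<in> L" "b \<in> L" "braid_letters n a b"
    and "x < s a x" "w (s a x) < w x"
    and "y < s b y" "w (s a (s b y)) < w (s a y)"
    and "z < s a z" "w (s a (s b (s a z))) < w (s a (s b z))"
  shows "has_braid w"
proof -
  obtain xs where "reduced_word F n (w \<circ> s a \<circ> s b \<circ> s a) xs"
    using reduced_word_exists group_gen assms(1-3) by blast
  then have "reduced_word F n (w \<circ> s a \<circ> s b) (xs @ [a])"
    using reduced_word_snoc[of a z "w \<circ> s a \<circ> s b"] assms by simp
  then have "reduced_word F n (w \<circ> s a) (xs @ [a] @ [b])"
    using reduced_word_snoc[of b y "w \<circ> s a" "xs @ [a]"] assms by simp
  then have "reduced_word F n w (xs @ [a, b, a])"
    using reduced_word_snoc[of a x w "xs @ [a, b]"] assms by simp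
  then show ?thesis using assms(4) unfolding has_braid_def
    by (metis sublist_append_leftI)
qed

subsection \<open>Shrinking a pattern\<close>

text \<open>One letter \<open>a\<close> exchanges both outer pairs and so brings the extreme values
  \<open>w i\<close> and \<open>w k\<close> to the middle positions. There \<open>b\<close>
  exchanges them, after which \<open>a\<close> has a descent again, with the values
  \<open>w q\<close> and \<open>w k\<close> in the positions \<open>i\<close> and \<open>q\<close>.
  The order of \<open>w q\<close> and \<open>w j\<close> does not matter.\<close>

lemma has_braid_4231_consecutive:
  assumes "w \<in> W" "c \<in> L"
    and "neighbours U i q" "neighbours U q j" "neighbours U j k" "s c i = q" "s c j = k"
    and "w q < w i" "w j < w i" "w k < w q" "w k < w j"
  shows "has_braid w"
proof -
  obtain a b where ab: "a \<in> L" "b \<in> L" "s a i = q" "s b q = j" "s a j = k" "s b i = i"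
    "braid_letters n a b"
    using braid4[OF assms(3-5) assms(2,6,7)] by blast
  have "s a q = i" using gen_invol[OF ab(1), of i] ab(3) by simp
  moreover have "i < q" "q < j" using assms by (auto simp: neighbours_def)
  ultimately show ?thesis
    using has_braid_three_descents[OF assms(1) ab(1,2,7), of i q i] ab assms by simp
qed

text \<open>\<open>IH\<close> is the induction hypothesis for narrower \<open>321\<close> patterns.
  If there is a further position between \<open>q\<close> and \<open>j\<close>, its value either
  forms a narrower pattern with two of the given positions, or lies strictly between
  \<open>w k\<close> and \<open>w i\<close>; then \<open>w \<circ> s c\<close> has a pattern in the
  inner positions.\<close>

lemma has_braid_4231:
  assumes IH: "\<And>w' i' j' k'. w' \<in> W \<Longrightarrow> i' \<in> U \<Longrightarrow> j' \<in> U \<Longrightarrow> k' \<in> U \<Longrightarrow> i' < j' \<Longrightarrow> j' < k' \<Longrightarrow>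
      w' j' < w' i' \<Longrightarrow> w' k' < w' j' \<Longrightarrow> k' - i' < k - i \<Longrightarrow> has_braid w'"
    and w: "w \<in> W" and c: "c \<in> L"
    and nb: "neighbours U i q" "neighbours U j k" and "q < j" and sc: "s c i = q" "s c j = k"
    and val: "w q < w i" "w j < w i" "w k < w q" "w k < w j"
  shows "has_braid w"
proof (cases "neighbours U q j")
  case True
  then show ?thesis using has_braid_4231_consecutive[OF w c nb(1) _ nb(2)] sc val by blast
next
  case False
  have U: "i \<in> U" "q \<in> U" "j \<in> U" "k \<in> U" "i < q" "j < k"
    using nb by (auto simp: neighbours_def)
  then obtain p where p: "p \<in> U" "q < p" "p < j"
    using False \<open>q < j\<close> by (auto simp: neighbours_def)
  have large: "has_braid w" if "p' \<in> U" "q < p'" "p' < j" "w i \<le> w p'" for p'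
    using IH[OF w that(1) U(3,4)] that U val by simp
  have small: "has_braid w" if "p' \<in> U" "q < p'" "p' < j" "w p' \<le> w k" for p'
    using IH[OF w U(1,2) that(1)] that U val by simp
  have inv: "s c q = i" "s c k = j" using gen_invol[OF c] sc by metis+
  \<comment> \<open>The value of \<open>w \<circ> s c\<close> at \<open>p\<close> is
    \<open>w p'\<close>. Since \<open>s c\<close> lets no point pass over \<open>i\<close> or
    \<open>k\<close>, the point \<open>p'\<close> also stays strictly between \<open>q\<close> and
    \<open>j\<close>.\<close>
  define p' where "p' = s c p"
  have p': "p' \<in> U" "s c p' = p" using p(1) gen_unfrozen c by (auto simp: p'_def)
  have "q < p'"
  proof (rule ccontr)
    assume "\<not> q < p'"
    moreover have "p' \<noteq> q" using p' inv p U by auto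
    ultimately have "s c p < s c i" by (simp add: p'_def sc)
    then show False using gen_inversion[OF c U(1) p(1)] p U sc by simp
  qed
  moreover have "p' < j"
  proof (rule ccontr)
    assume "\<not> p' < j"
    moreover have "p' \<noteq> j" using p' sc p U by auto
    ultimately have "s c k < s c p" by (simp add: p'_def inv)
    then have "s c p = k" using gen_inversion[OF c p(1) U(4)] p U by simp
    then show False using p' inv p by (simp add: p'_def)
  qed
  ultimately consider "has_braid w" | "w p' < w i" "w k < w p'"
    using large[OF p'(1)] small[OF p'(1)] by linarith
  then show ?thesis
  proof cases
    case 2
    have "has_braid (w \<circ> s c)"
      using IH[OF group_gen[OF w c] U(2) p(1) U(3)] 2 p U by (simp add: inv sc p'_def)
    then show ?thesis using has_braid_step[OF c, of i] sc U val by simp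
  qed
qed

text \<open>If \<open>b\<close> fixes \<open>i\<close> and \<open>a\<close> fixes \<open>k\<close>,
  the three positions can be reversed by the letters in either order, and the one that may occur
  twice is chosen. Otherwise the letter that moves the far end exchanges it with a fourth
  consecutive position, and the descent at this second pair gives a \<open>4231\<close>
  pattern.\<close>

lemma has_braid_321_consecutive:
  assumes w: "w \<in> W" and nb: "neighbours U i j" "neighbours U j k" and val: "w j < w i" "w k < w j"
  shows "has_braid w"
proof -
  obtain a b where ab: "a \<in> L" "b \<in> L" "s a i = j" "s b j = k"
    "braid_letters n a b \<or> braid_letters n b a"
    using braid3[OF nb] by blast
  have ij: "i < j" and jk: "j < k" using nb by (auto simp: neighbours_def)
  have inv: "s a j = i" "s b k = j" using gen_invol ab by metis+
  have da: "descent w a" and db: "descent w b"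
    using descentI[OF w ab(1), of i] descentI[OF w ab(2), of j] ab ij jk val by auto
  consider (left) "s b i \<noteq> i" | (right) "s a k \<noteq> k" | (fixed) "s b i = i" "s a k = k" by blast
  then show ?thesis
  proof cases
    case left
    have "\<not> neighbours U i (s b i)"
    proof
      assume "neighbours U i (s b i)"
      then have "s b i = j" using nb(1) by (auto simp: neighbours_def) (metis linorder_less_linear)
      then show False using gen_invol[OF ab(2), of i] ab(4) ij jk by simp
    qed
    then have h: "neighbours U (s b i) i" using moved_neighbours[OF ab(2) left] by simp
    have "w i < w (s b i)"
      using descentD[OF db, of "s b i"] h ab(2) by (simp add: neighbours_def)
    then show ?thesis
      using has_braid_4231_consecutive[OF w ab(2) h nb] ab val by simp
  next
    case right
    have "\<not> neighbours U (s a k) k"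
    proof
      assume "neighbours U (s a k) k"
      then have "s a k = j" using nb(2) by (auto simp: neighbours_def) (metis linorder_less_linear)
      then show False using gen_invol[OF ab(1), of k] inv ij jk by simp
    qed
    then have h: "neighbours U k (s a k)" using moved_neighbours[OF ab(1) right] by simp
    have "w (s a k) < w k"
      using descentD[OF da, of k] h by (simp add: neighbours_def)
    then show ?thesis
      using has_braid_4231_consecutive[OF w ab(1) nb h] ab val by simp
  next
    case fixed
    from ab(5) show ?thesis
    proof
      assume "braid_letters n a b"
      then show ?thesis
        using has_braid_three_descents[OF w ab(1,2), of i j i] ab ij jk val fixed inv by simp
    next
      assume "braid_letters n b a"
      then show ?thesis
        using has_braid_three_descents[OF w ab(2,1), of j i j] ab ij jk val fixed inv by simp
    qed
  qed
qed

text \<open>Strong induction on the width \<open>k - i\<close>. The cases \<open>left\<close> and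
  \<open>right\<close> are mirror images. The generator that moves one end of the pattern inwards
  may also move the other two positions, whence the three subcases in each.\<close>

lemma has_braid_321:
  assumes "w \<in> W" "i \<in> U" "j \<in> U" "k \<in> U" "i < j" "j < k" "w j < w i" "w k < w j"
  shows "has_braid w"
  using assms
proof (induction "nat (k - i)" arbitrary: w i j k rule: less_induct)
  case less
  note w = less.prems(1) and U = less.prems(2-4) and ord = less.prems(5,6) and val = less.prems(7,8)
  have IH: "has_braid w'" if "w' \<in> W" "i' \<in> U" "j' \<in> U" "k' \<in> U" "i' < j'" "j' < k'"
      "w' j' < w' i'" "w' k' < w' j'" "k' - i' < k - i" for w' i' j' k'
    using less.hyps[OF _ that(1-8)] that(9) ord by simp
  consider "neighbours U i j" "neighbours U j k" | (left) "\<not> neighbours U i j"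
    | (right) "\<not> neighbours U j k" by blast
  then show ?case
  proof cases
    case 1
    then show ?thesis using has_braid_321_consecutive w val by blast
  next
    case left
    obtain q where q: "neighbours U i q" "q \<le> j" using neighbours_next U ord by metis
    then have qU: "q \<in> U" "i < q" "q < j" using left by (auto simp: neighbours_def order_le_less)
    show ?thesis
    proof (cases "w j < w q")
      case True
      then show ?thesis using IH[OF w qU(1) U(2,3)] qU ord val by simp
    next
      case False
      then have wq: "w q < w j" using group_inj[OF w, of q j] qU by force
      obtain a where a: "a \<in> L" "s a i = q" using gen_neighbours q(1) by blast
      have aq: "s a q = i" using gen_invol[OF a(1), of i] a(2) by simp
      have desc: "descent w a" using descentI[OF w a(1), of i] a qU wq val by simp
      have w': "w \<circ> s a \<in> W" using group_gen w a by blast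
      have aU: "s a j \<in> U" "s a k \<in> U" using gen_unfrozen a(1) U by blast+
      have inv: "s a (s a x) = x" for x using a(1) by simp
      have neq: "s a j \<noteq> q" "s a j \<noteq> s a k" using inv[of j] inv[of k] aq ord by auto
      \<comment> \<open>Otherwise \<open>s a\<close> would reverse \<open>i\<close> and
        \<open>j\<close> and hence exchange them, but it sends \<open>i\<close> to
        \<open>q\<close>.\<close>
      moreover have "\<not> s a j < q"
        using gen_inversion[OF a(1) U(1,2) ord(1)] a(2) qU by auto
      ultimately have "q < s a j" by simp
      consider (swap) "s a j = k" | (weak) "s a k \<le> k" "s a j < s a k" | (strict) "k < s a k" "s a j \<noteq> k"
        using gen_inversion[OF a(1) U(2,3) ord(2)] neq by linarith
      then show ?thesis
      proof cases
        case swap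
        then have "neighbours U j k"
          using moved_neighbours[OF a(1), of j] ord by (auto simp: neighbours_def)
        \<comment> \<open>The pairs \<open>i, q\<close> and \<open>j, k\<close> are symmetric to
          each other, so \<open>w j < w i\<close> also yields this last inequality of the
          \<open>4231\<close> pattern.\<close>
        moreover have "w k < w q"
          using two_pairs_swapped[OF w a(1), of i j] swap a ord qU val by simp
        ultimately show ?thesis
          using has_braid_4231[OF IH w a(1) q(1) _ qU(3) a(2) swap] wq val by simp
      next
        case weak
        then have "has_braid (w \<circ> s a)"
          using IH[OF w' qU(1) aU] \<open>q < s a j\<close> aq inv val qU by simp
        then show ?thesis using has_braid_step[OF a(1), of i] a qU wq val by simp
      next
        case strict
        \<comment> \<open>Here \<open>s a\<close> raises \<open>k\<close>, and the descent makes the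
          value of \<open>w \<circ> s a\<close> at \<open>k\<close> smaller than \<open>w k\<close>.
          So \<open>k\<close> can stay the last position, and the pattern does not grow on the
          right.\<close>
        have "\<not> k < s a j"
          using gen_inversion[OF a(1) U(3) aU(1)] inv[of j] neq strict ord by auto
        then have "s a j < k" using strict by simp
        then have "has_braid (w \<circ> s a)"
          using IH[OF w' qU(1) aU(1) U(3)] \<open>q < s a j\<close> aq inv val qU descentD[OF desc strict(1)] by simp
        then show ?thesis using has_braid_step[OF a(1), of i] a qU wq val by simp
      qed
    qed
  next
    case right
    obtain q where q: "neighbours U q k" "j \<le> q" using neighbours_previous U ord by metis
    then have qU: "q \<in> U" "q < k" "j < q" using right by (auto simp: neighbours_def order_le_less)
    show ?thesis
    proof (cases "w q < w j")
      case True
      then show ?thesis using IH[OF w U(1,2) qU(1)] qU ord val by simp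
    next
      case False
      then have wq: "w j < w q" using group_inj[OF w, of q j] qU by force
      obtain a where a: "a \<in> L" "s a q = k" using gen_neighbours q(1) by blast
      have ak: "s a k = q" using gen_invol[OF a(1), of q] a(2) by simp
      have desc: "descent w a" using descentI[OF w a(1), of q] a qU wq val by simp
      have w': "w \<circ> s a \<in> W" using group_gen w a by blast
      have aU: "s a i \<in> U" "s a j \<in> U" using gen_unfrozen a(1) U by blast+
      have inv: "s a (s a x) = x" for x using a(1) by simp
      have neq: "s a j \<noteq> q" "s a i \<noteq> s a j" using inv[of j] inv[of i] a(2) ord by auto
      moreover have "\<not> q < s a j"
        using gen_inversion[OF a(1) U(2,3) ord(2)] inv[of j] ak ord qU by auto
      ultimately have "s a j < q" by simp
      consider (swap) "s a i = j" | (weak) "i \<le> s a i" "s a i < s a j" | (strict) "s a i < i" "s a i \<noteq> j"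
        using gen_inversion[OF a(1) U(1,2) ord(1)] neq by linarith
      then show ?thesis
      proof cases
        case swap
        then have "neighbours U i j"
          using moved_neighbours[OF a(1), of i] ord by (auto simp: neighbours_def)
        moreover have "w q < w i"
          using two_pairs_swapped[OF w a(1), of i q] swap a ord qU val by simp
        ultimately show ?thesis
          using has_braid_4231[OF IH w a(1) _ q(1) qU(3) swap a(2)] wq val by simp
      next
        case weak
        then have "has_braid (w \<circ> s a)"
          using IH[OF w' aU qU(1)] \<open>s a j < q\<close> ak a(2) inv val qU by simp
        then show ?thesis using has_braid_step[OF a(1), of q] a qU wq val by simp
      next
        case strict
        \<comment> \<open>As on the other side, \<open>w \<circ> s a\<close> has an even larger
          value at \<open>i\<close> than \<open>w\<close>, so \<open>i\<close> stays the first
          position.\<close>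
        have "s a j \<noteq> i" using inv[of j] strict ord by auto
        moreover have "\<not> s a j < i"
          using gen_inversion[OF a(1) aU(2) U(1)] inv[of j] neq strict ord by auto
        ultimately have "i < s a j" by simp
        moreover have "w i < w (s a i)" using descentD[OF desc, of "s a i"] strict inv by simp
        ultimately have "has_braid (w \<circ> s a)"
          using IH[OF w' U(1) aU(2) qU(1)] \<open>s a j < q\<close> ak a(2) inv val qU by simp
        then show ?thesis using has_braid_step[OF a(1), of q] a qU wq val by simp
      qed
    qed
  qed
qed

lemma braid_if_globally_contains_321:
  assumes "w \<in> W" "globally_contains_321 F n w"
  shows "\<exists>xs. reduced_word F n w xs \<and>
    (\<exists>x\<in>{1..n - 1}. sublist [x, x + 1, x] xs \<or> sublist [x, x - 1, x] xs)"
proof -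
  have "has_braid w"
    using assms has_braid_321[OF assms(1)] by (auto simp: globally_contains_321_def)
  then show ?thesis unfolding has_braid_def braid_letters_def by blast
qed

end

section \<open>The finite groups\<close>

text \<open>An increasing surjection onto the integers skips no value, so consecutive integers have
  consecutive images.\<close>

lemma increasing_bij_int:
  fixes f :: "int \<Rightarrow> int"
  assumes "bij f" and step: "\<And>x. f x < f (x + 1)"
  shows "f x = f 0 + x"
proof -
  have less: "f x < f y" if "x < y" for x y
    using that by (induction y rule: int_gr_induct) (use step less_trans in blast)+
  have mono: "f x < f y \<longleftrightarrow> x < y" for x y
    using less[of x y] less[of y x] by (cases x y rule: linorder_cases) auto
  have succ: "f (x + 1) = f x + 1" for x
  proof -
    obtain y where y: "f y = f x + 1" using assms(1) by (metis bij_pointE)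
    have "x < y" using y mono[of x y] by linarith
    moreover have "y \<le> x + 1" using step[of x] y mono[of "x + 1" y] by linarith
    ultimately have "y = x + 1" by simp
    then show ?thesis using y by simp
  qed
  have pred: "f (x - 1) = f x - 1" for x using succ[of "x - 1"] by simp
  show ?thesis by (induction x rule: int_induct[of _ 0]) (simp_all add: succ pred)
qed

text \<open>The map is the identity outside the interval and keeps the interval, so it also
  increases across both ends. It is therefore a shift, and a shift with a fixed point is the
  identity.\<close>

lemma increasing_permutes_int:
  fixes w :: "int \<Rightarrow> int"
  assumes "w permutes {a..b}" "\<And>x. a \<le> x \<Longrightarrow> x < b \<Longrightarrow> w x < w (x + 1)"
  shows "w = id"
proof -
  have out: "x \<notin> {a..b} \<Longrightarrow> w x = x" for x using assms(1) by (rule permutes_not_in)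
  have ins: "x \<in> {a..b} \<Longrightarrow> w x \<in> {a..b}" for x using permutes_in_image[OF assms(1)] by simp
  have "w x < w (x + 1)" for x
    using assms(2)[of x] out[of x] out[of "x + 1"] ins[of x] ins[of "x + 1"]
    by (cases "x \<in> {a..b}"; cases "x + 1 \<in> {a..b}") auto
  then have *: "w x = w 0 + x" for x using increasing_bij_int permutes_bij[OF assms(1)] by blast
  have "w (b + 1) = b + 1" by (rule out) simp
  then have "w 0 = 0" using *[of "b + 1"] by simp
  then have "w x = id x" for x using *[of x] by simp
  then show ?thesis ..
qed

lemma symmetries_0: "symmetries 0 r = (if r then {id, uminus} else {id})"
  by (auto simp: symmetries_def id_def fun_eq_iff)

lemma window_group_Sym: "window_group Sym n 0 False {1..int n} int (\<lambda>a. int a + 1)"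
proof -
  have nb: "neighbours {1..int n} x y \<longleftrightarrow> x \<in> {1..int n} \<and> y \<in> {1..int n} \<and> y = x + 1" for x y
    by (rule neighbours_iff_next) auto
  have gen: "gen Sym n a permutes {1..int n}" if "a \<in> letters Sym n" for a
    using that by (auto intro: permutes_swap_id)
  show ?thesis
  proof (unfold_locales, unfold unfrozen.simps nb)
    show "w = id" if "w \<in> perm_group Sym n" "\<And>x y. x \<in> {1..int n} \<and> y \<in> {1..int n} \<and> y = x + 1 \<Longrightarrow> w x < w y" for w
      using that increasing_permutes_int[of w 1 "int n"] by simp
    show "w \<circ> gen Sym n a \<in> perm_group Sym n" if "w \<in> perm_group Sym n" "a \<in> letters Sym n" for w a
      using that permutes_compose[OF gen] by simp
    show "(\<Sum>x\<in>{1..int n}. h (gen Sym n a x)) = (\<Sum>x\<in>{1..int n}. h x)" if "a \<in> letters Sym n" for a h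
      using sum.permute[OF gen[OF that], of h] by (simp add: comp_def)
    show "\<exists>a\<in>letters Sym n. gen Sym n a x = y" if "x \<in> {1..int n} \<and> y \<in> {1..int n} \<and> y = x + 1" for x y
      using that by (intro bexI[of _ "nat x"]) auto
    show "\<exists>a\<in>letters Sym n. \<exists>b\<in>letters Sym n. gen Sym n a x = y \<and> gen Sym n b y = z \<and>
        (braid_letters n a b \<or> braid_letters n b a)"
      if "x \<in> {1..int n} \<and> y \<in> {1..int n} \<and> y = x + 1" "y \<in> {1..int n} \<and> z \<in> {1..int n} \<and> z = y + 1" for x y z
      using that by (intro bexI[of _ "nat x"] bexI[of _ "nat y"]) (auto simp: braid_letters_def)
    show "x = y" if "w \<in> perm_group Sym n" "w x = w y" for w x y
      using that permutes_inj[of w] by (auto dest: injD)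
    show "w x \<in> {1..int n}" if "w \<in> perm_group Sym n" "x \<in> {1..int n}" for w x
      using that permutes_in_image[of w "{1..int n}" x] by simp
    show "\<exists>g\<in>symmetries 0 False. x = g (int a) \<or> x = g (int a + 1)"
      if "gen Sym n a x \<noteq> x" for a x
      using that by (auto simp: symmetries_0 transpose_def split: if_splits)
    show "\<exists>a\<in>letters Sym n. \<exists>b\<in>letters Sym n. gen Sym n a x = y \<and> gen Sym n b y = z \<and>
        gen Sym n a z = t \<and> gen Sym n b x = x \<and> braid_letters n a b"
      if "x \<in> {1..int n} \<and> y \<in> {1..int n} \<and> y = x + 1"
        "y \<in> {1..int n} \<and> z \<in> {1..int n} \<and> z = y + 1"
        "z \<in> {1..int n} \<and> t \<in> {1..int n} \<and> t = z + 1"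
        "gen Sym n c x = y" "gen Sym n c z = t" for x y z t c
    proof -
      \<comment> \<open>A generator raises only one point, so it cannot raise both \<open>x\<close>
        and \<open>z\<close>, and the case is vacuous.\<close>
      have "x' = int c" if "gen Sym n c x' = x' + 1" for x'
        using that by (cases "x' = int c"; cases "x' = int c + 1") (simp_all add: transpose_def)
      moreover have "y = x + 1" "t = z + 1" "z \<noteq> x" using that(1-3) by auto
      ultimately have False using that(4,5) by metis
      then show ?thesis ..
    qed
  qed (auto simp: symmetries_0)
qed

lemma gen_SymB_pos:
  assumes "0 < a"
  shows "gen SymB n a x = (if x = int a then x + 1 else if x = int a + 1 then x - 1
    else if x = - int a then x - 1 else if x = - int a - 1 then x + 1 else x)"
  using assms
  by (cases "x = int a"; cases "x = int a + 1"; cases "x = - int a"; cases "x = - int a - 1")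
    (simp_all add: transpose_def)

lemma gen_SymB_0: "gen SymB n 0 x = (if x = - 1 then 1 else if x = 1 then - 1 else x)"
  by (simp add: transpose_def)

lemma window_group_SymB:
  "window_group SymB n 0 True {- int n..int n} (\<lambda>a. if a = 0 then - 1 else int a) (\<lambda>a. int a + 1)"
proof -
  let ?U = "{- int n..int n} - {0}"
  have nb: "neighbours ?U x y \<longleftrightarrow> x \<in> ?U \<and> y \<in> ?U \<and> y = (if x = - 1 then 1 else x + 1)" for x y
    by (rule neighbours_iff_next) auto
  have gen: "gen SymB n a permutes {- int n..int n}" if "a \<in> letters SymB n" for a
    using that by (auto intro!: permutes_swap_id permutes_compose)
  have odd_gen: "gen SymB n a (- x) = - gen SymB n a x" for a x
    by (cases "a = 0") (auto simp: gen_SymB_0 gen_SymB_pos simp del: gen.simps)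
  have odd: "w (- x) = - w x" if "w \<in> perm_group SymB n" for w x
    using that permutes_not_in[of w "{- int n..int n}"] by (cases "x \<in> {- int n..int n}") auto
  show ?thesis
  proof (unfold_locales, unfold unfrozen.simps nb)
    show "w \<circ> gen SymB n a \<in> perm_group SymB n" if "w \<in> perm_group SymB n" "a \<in> letters SymB n" for w a
      using that permutes_compose[OF gen[OF that(2)]] odd[OF that(1)] odd_gen by simp
    show "(\<Sum>x\<in>{- int n..int n}. h (gen SymB n a x)) = (\<Sum>x\<in>{- int n..int n}. h x)" if "a \<in> letters SymB n" for a h
      using sum.permute[OF gen[OF that], of h] by (simp add: comp_def)
    show "w = id" if w: "w \<in> perm_group SymB n"
      and inc: "\<And>x y. x \<in> ?U \<and> y \<in> ?U \<and> y = (if x = - 1 then 1 else x + 1) \<Longrightarrow> w x < w y" for w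
    proof (rule increasing_permutes_int)
      show "w permutes {- int n..int n}" using w by simp
      fix x assume x: "- int n \<le> x" "x < int n"
      have "w 0 = 0" "w (- 1) = - w 1" using odd[OF w, of 0] odd[OF w, of 1] by auto
      then show "w x < w (x + 1)"
        using inc[of x "x + 1"] inc[of "- 1" 1] x by (cases "x = 0"; cases "x = - 1") auto
    qed
    \<comment> \<open>The letter that exchanges \<open>x\<close> with its successor. For negative
      \<open>x\<close> the pair is the mirror image of \<open>- x - 1, - x\<close>, with
      \<open>- 1, 1\<close> receiving the letter \<open>0\<close>.\<close>
    define l where "l x = nat (if 0 < x then x else - x - 1)" for x :: int
    have l: "l x \<in> letters SymB n \<and> gen SymB n (l x) x = y"
      if "x \<in> ?U \<and> y \<in> ?U \<and> y = (if x = - 1 then 1 else x + 1)" for x y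
      using that by (cases "0 < x"; cases "x = - 1")
        (auto simp: l_def gen_SymB_0 gen_SymB_pos simp del: gen.simps)
    then show "\<exists>a\<in>letters SymB n. gen SymB n a x = y"
      if "x \<in> ?U \<and> y \<in> ?U \<and> y = (if x = - 1 then 1 else x + 1)" for x y
      using that by blast
    show "\<exists>a\<in>letters SymB n. \<exists>b\<in>letters SymB n. gen SymB n a x = y \<and> gen SymB n b y = z \<and>
        (braid_letters n a b \<or> braid_letters n b a)"
      if "x \<in> ?U \<and> y \<in> ?U \<and> y = (if x = - 1 then 1 else x + 1)"
        "y \<in> ?U \<and> z \<in> ?U \<and> z = (if y = - 1 then 1 else y + 1)" for x y z
    proof -
      \<comment> \<open>The letters increase along the positive integers and decrease along the
        negative ones. At the turn, \<open>x = - 1\<close>, they are \<open>0\<close> and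
        \<open>1\<close>, and \<open>1\<close> is the one to be repeated.\<close>
      consider m where "x = int m + 1" | "x = - 1" | m where "x = - int m - 2"
      proof (cases "0 < x \<or> x = - 1")
        case True
        then show thesis using that(1)[of "nat (x - 1)"] that(2) by auto
      next
        case False
        then show thesis using that(3)[of "nat (- x - 2)"] \<open>x \<in> ?U \<and> _ \<and> _\<close> by auto
      qed
      then have "braid_letters n (l x) (l y) \<or> braid_letters n (l y) (l x)"
        using that by cases (auto simp: l_def braid_letters_def nat_add_distrib)
      then show ?thesis using l[OF that(1)] l[OF that(2)] by blast
    qed
    show "\<exists>a\<in>letters SymB n. \<exists>b\<in>letters SymB n. gen SymB n a x = y \<and> gen SymB n b y = z \<and>
        gen SymB n a z = t \<and> gen SymB n b x = x \<and> braid_letters n a b"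
      if "x \<in> ?U \<and> y \<in> ?U \<and> y = (if x = - 1 then 1 else x + 1)"
        "y \<in> ?U \<and> z \<in> ?U \<and> z = (if y = - 1 then 1 else y + 1)"
        "z \<in> ?U \<and> t \<in> ?U \<and> t = (if z = - 1 then 1 else z + 1)"
        "c \<in> letters SymB n" "gen SymB n c x = y" "gen SymB n c z = t" for x y z t c
    proof -
      have "l x' = c" if "gen SymB n c x' = (if x' = - 1 then 1 else x' + 1)" for x'
      proof (cases "c = 0")
        case True
        then show ?thesis using that
          by (cases "x' = - 1"; cases "x' = 1") (simp_all add: l_def gen_SymB_0 del: gen.simps)
      next
        case False
        then show ?thesis using that
          by (cases "x' = int c"; cases "x' = int c + 1"; cases "x' = - int c"; cases "x' = - int c - 1")
            (simp_all add: l_def gen_SymB_pos del: gen.simps split: if_splits)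
      qed
      then have lxz: "l x = l z" using that by metis
      have z: "z = (if x = - 1 then 2 else if x = - 2 then 1 else x + 2)" using that(1,2) by auto
      have "x \<noteq> 0" using that(1) by simp
      \<comment> \<open>Pairs with equal letters that are one gap apart occur only around
        \<open>0\<close>: they are \<open>- 2, - 1\<close> and \<open>1, 2\<close>, both with the
        letter \<open>1\<close>.\<close>
      then consider "0 < x" | "x = - 1" | "x = - 2" | "x < - 2" by linarith
      then have "x = - 2" using lxz z by cases (simp_all add: l_def)
      then have "x = - 2 \<and> y = - 1 \<and> z = 1 \<and> t = 2" using that(1-3) by simp
      then show ?thesis using that(1)
        by (intro bexI[of _ "1::nat"] bexI[of _ "0::nat"])
          (auto simp: gen_SymB_0 gen_SymB_pos braid_letters_def simp del: gen.simps)
    qed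
    show inj: "x = y" if "w \<in> perm_group SymB n" "w x = w y" for w x y
      using that permutes_inj[of w] by (auto dest: injD)
    show "w x \<in> ?U" if w: "w \<in> perm_group SymB n" and "x \<in> ?U" for w x
      using that permutes_in_image[of w "{- int n..int n}" x] odd[OF w, of 0] inj[OF w, of x 0] by auto
    show "\<exists>g\<in>symmetries 0 True. x = g (if a = 0 then - 1 else int a) \<or> x = g (int a + 1)"
      if "gen SymB n a x \<noteq> x" for a x
      using that by (cases "a = 0")
        (auto simp: symmetries_0 gen_SymB_0 gen_SymB_pos simp del: gen.simps split: if_splits)
    show "gen SymB n a (if a = 0 then - 1 else int a) = int a + 1"
      "gen SymB n a (int a + 1) = (if a = 0 then - 1 else int a)" for a
      by (cases "a = 0"; auto simp: gen_SymB_0 gen_SymB_pos simp del: gen.simps)+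
    show "w (g x) = g (w x)" if "w \<in> perm_group SymB n" "g \<in> symmetries 0 True" for w g x
      using that(2) odd[OF that(1), of x] by (auto simp: symmetries_0)
    show "g x \<in> ?U" if "g \<in> symmetries 0 True" "x \<in> ?U" for g x
      using that by (auto simp: symmetries_0)
    show "\<exists>g\<in>symmetries 0 True. g x \<in> {- int n..int n}" if "x \<in> ?U" for x
      using that by (intro bexI[of _ id]) (auto simp: symmetries_0)
    show "id \<in> perm_group SymB n" by (simp add: permutes_id)
    show "(if a = 0 then - 1 else int a) \<in> ?U \<and> int a + 1 \<in> ?U \<and>
        int a + 1 = (if (if a = 0 then - 1 else int a) = - 1 then 1 else (if a = 0 then - 1 else int a) + 1)"
      if "a \<in> letters SymB n" for a
      using that by (cases "a = 0") simp_all
  qed (rule finite_atLeastAtMost_int)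
qed

section \<open>The affine groups\<close>

lemma shift_multiple:
  fixes f :: "int \<Rightarrow> int"
  assumes "\<And>x. f (x + N) = f x + M" "N dvd c"
  shows "f (x + c) = f x + M * (c div N)"
proof -
  have "f (x + N * k) = f x + M * k" for k
  proof (induction k rule: int_induct[of _ 0])
    case (step1 k)
    then show ?case using assms(1)[of "x + N * k"] by (simp add: algebra_simps)
  next
    case (step2 k)
    then show ?case using assms(1)[of "x + N * (k - 1)"] by (simp add: algebra_simps)
  qed simp
  from this[of "c div N"] show ?thesis using assms(2) by simp
qed

lemma equivariant_shift:
  fixes f :: "int \<Rightarrow> int"
  assumes "\<And>x. f (x + N) = f x + N" "N dvd c"
  shows "f (x + c) = f x + c"
  using shift_multiple[of f N N c x] assms by simp

lemma periodic_shift: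
  fixes f :: "int \<Rightarrow> int"
  assumes "\<And>x. f (x + N) = f x" "N dvd c"
  shows "f (x + c) = f x"
  using shift_multiple[of f N 0 c x] assms by simp

lemma window_representative:
  fixes N :: int
  assumes "0 < N"
  obtains c where "N dvd c" "x + c \<in> {1..N}"
proof
  \<comment> \<open>The window starts at \<open>1\<close>, so the representative of \<open>x\<close>
    is \<open>(x - 1) mod N + 1\<close>.\<close>
  show "N dvd - N * ((x - 1) div N)" by simp
  have "x + - N * ((x - 1) div N) = (x - 1) mod N + 1"
    using div_mult_mod_eq[of "x - 1" N] by (simp add: algebra_simps)
  moreover have "(x - 1) mod N + 1 \<le> N" using pos_mod_bound[OF assms, of "x - 1"] by linarith
  ultimately show "x + - N * ((x - 1) div N) \<in> {1..N}" using assms by simp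
qed

text \<open>This is the tool for telling residue classes apart: conditions of divisibility by
  \<open>N\<close> on two expressions that differ by a small nonzero constant exclude each
  other.\<close>

lemma dvd_close:
  fixes N :: int
  assumes "N dvd u" "N dvd v" "\<bar>u - v\<bar> < N"
  shows "u = v"
  using assms zdvd_not_zless[of "\<bar>u - v\<bar>" N] by (cases "u = v") auto

text \<open>\<open>f\<close> permutes the residue classes modulo \<open>N\<close>. Correcting each
  \<open>f x\<close> by a multiple \<open>c x\<close> of \<open>N\<close> brings it back into the
  window; the corrected map is injective there, hence a bijection by finiteness.\<close>

lemma sum_window_periodic:
  fixes f h :: "int \<Rightarrow> int"
  assumes "0 < N" "inj f" "\<And>x. f (x + N) = f x + N" "\<And>x. h (x + N) = h x"
  shows "(\<Sum>x = 1..N. h (f x)) = (\<Sum>x = 1..N. h x)"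
proof -
  have "\<exists>c. N dvd c \<and> f x + c \<in> {1..N}" for x
    using window_representative[OF assms(1)] by metis
  then obtain c where c: "\<And>x. N dvd c x" "\<And>x. f x + c x \<in> {1..N}" by metis
  have "inj_on (\<lambda>x. f x + c x) {1..N}"
  proof
    fix x y assume xy: "x \<in> {1..N}" "y \<in> {1..N}" "f x + c x = f y + c y"
    have d: "N dvd c y - c x" using c(1) by simp
    have "f x = f (y + (c y - c x))" using equivariant_shift[of f, OF assms(3) d] xy(3) by simp
    then have "x = y + (c y - c x)" using assms(2) by (auto dest: injD)
    then have "x - y = c y - c x" by simp
    then have "N dvd x - y" using d by simp
    then have "x - y = 0" using dvd_close[of N "x - y" 0] xy by auto
    then show "x = y" by simp
  qed
  then have "bij_betw (\<lambda>x. f x + c x) {1..N} {1..N}"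
    unfolding bij_betw_def using endo_inj_surj[of "{1..N}" "\<lambda>x. f x + c x"] c(2) by blast
  then have "(\<Sum>x = 1..N. h (f x + c x)) = (\<Sum>x = 1..N. h x)" by (rule sum.reindex_bij_betw)
  then show ?thesis using periodic_shift[of h, OF assms(4) c(1)] by simp
qed

lemma periodic_swap_shift:
  assumes "N dvd c"
  shows "periodic_swap N a b (x + c) = periodic_swap N a b x + c"
proof -
  have "N dvd x + c - d \<longleftrightarrow> N dvd x - d" for d
    using dvd_add_left_iff[OF assms, of "x - d"] by (simp add: algebra_simps)
  then show ?thesis by (simp add: periodic_swap_def)
qed

lemma periodic_swap_invol:
  assumes "\<not> N dvd b - a"
  shows "periodic_swap N a b (periodic_swap N a b x) = x"
proof -
  have "\<not> N dvd x + (b - a) - a" if "N dvd x - a"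
    using dvd_add_right_iff[OF that, of "b - a"] assms by (simp add: algebra_simps)
  then show ?thesis by (simp add: periodic_swap_def)
qed

lemma bij_periodic_swap:
  assumes "\<not> N dvd b - a"
  shows "bij (periodic_swap N a b)"
  using periodic_swap_invol[OF assms] by (metis bijI')

lemma sum_integers_upto: "(\<Sum>i = 1..int n. i) = int ((n + 1) choose 2)"
proof (induction n)
  case (Suc n)
  have "{1..int (Suc n)} = insert (int n + 1) {1..int n}" by auto
  then show ?case using Suc by (simp add: numeral_2_eq_2)
qed (simp add: numeral_2_eq_2)

text \<open>For \<open>n \<ge> 3\<close> neither \<open>1\<close> nor \<open>2\<close> is divisible
  by \<open>n\<close>. The first makes the generators involutions, the second prevents a generator
  from raising both \<open>x\<close> and \<open>x + 2\<close>.\<close>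

lemma window_group_AffSym:
  assumes "3 \<le> n"
  shows "window_group AffSym n (int n) False {1..int n} int (\<lambda>a. int a + 1)"
proof -
  let ?N = "int n"
  have nb: "neighbours UNIV x y \<longleftrightarrow> x \<in> UNIV \<and> y \<in> UNIV \<and> y = x + 1" for x y :: int
    by (rule neighbours_iff_next) auto
  \<comment> \<open>The normalisation is restated with the summands \<open>w i - i\<close>, which
    are periodic, so that sums over the window can be reindexed.\<close>
  have group: "w \<in> perm_group AffSym n \<longleftrightarrow>
      bij w \<and> (\<forall>i. w (i + ?N) = w i + ?N) \<and> (\<Sum>i = 1..?N. w i - i) = 0" for w
    by (simp add: sum_subtractf sum_integers_upto)
  have translation: "w (x + c) = w x + c" if "w \<in> perm_group AffSym n" "?N dvd c" for w x c
    using equivariant_shift[of w, OF _ that(2)] that(1) by simp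
  have symmetryE: "\<exists>c. ?N dvd c \<and> g = (\<lambda>x. x + c)" if "g \<in> symmetries ?N False" for g
    using that by (auto simp: symmetries_def)
  have not_dvd: "\<not> ?N dvd 1" "\<not> ?N dvd 2" using assms by (auto dest: zdvd_imp_le)
  have bij_gen: "bij (gen AffSym n a)" for a using bij_periodic_swap[of ?N] not_dvd by simp
  have gen_shift: "gen AffSym n a (x + c) = gen AffSym n a x + c" if "?N dvd c" for a x c
    using periodic_swap_shift[OF that] by simp
  have gen_invol: "gen AffSym n a (gen AffSym n a x) = x" for a x
    using periodic_swap_invol not_dvd by simp
  have window: "(\<Sum>x = 1..?N. h (gen AffSym n a x)) = (\<Sum>x = 1..?N. h x)"
    if "\<And>x. h (x + ?N) = h x" for a and h :: "int \<Rightarrow> int"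
    by (rule sum_window_periodic) (use assms that bij_is_inj[OF bij_gen] gen_shift in \<open>simp_all del: gen.simps\<close>)
  have up: "?N dvd x - int a" if "gen AffSym n a x = x + 1" for x a
    using that by (simp add: periodic_swap_def split: if_splits)
  have gen_dvd: "gen AffSym n a x = x + 1" if "?N dvd x - int a" for x a
    using that by (simp add: periodic_swap_def)
  have dvd_mod: "?N dvd x - int (nat (x mod ?N))" "nat (x mod ?N) < n" for x
    using assms by (simp_all add: nat_less_iff)
  show ?thesis
  proof (unfold_locales, unfold unfrozen.simps nb)
    show "w \<circ> gen AffSym n a \<in> perm_group AffSym n" if w: "w \<in> perm_group AffSym n" for w a
    proof -
      let ?s = "gen AffSym n a"
      have "(\<Sum>i = 1..?N. w (?s i) - ?s i) = (\<Sum>i = 1..?N. w i - i)"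
        by (rule window) (use w in simp)
      \<comment> \<open>Reindexing by the involution \<open>?s\<close> changes the sign of its own
        total displacement, which is therefore zero.\<close>
      moreover have "(\<Sum>i = 1..?N. ?s (?s i) - ?s i) = (\<Sum>i = 1..?N. ?s i - i)"
        by (rule window) (use gen_shift[OF dvd_refl, of a] in \<open>simp del: gen.simps\<close>)
      then have "- (\<Sum>i = 1..?N. ?s i - i) = (\<Sum>i = 1..?N. ?s i - i)"
        unfolding gen_invol sum_negf[symmetric] by simp
      then have "(\<Sum>i = 1..?N. ?s i - i) = 0" unfolding neg_equal_zero .
      moreover have "(\<Sum>i = 1..?N. w (?s i) - i)
          = (\<Sum>i = 1..?N. w (?s i) - ?s i) + (\<Sum>i = 1..?N. ?s i - i)"
        unfolding sum.distrib[symmetric] by simp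
      ultimately have "(\<Sum>i = 1..?N. w (?s i) - i) = 0" using w group by simp
      moreover have "bij (w \<circ> ?s)" using w group bij_gen bij_comp by blast
      moreover have "w (?s (i + ?N)) = w (?s i) + ?N" for i
        using translation[OF w dvd_refl] gen_shift[OF dvd_refl] by simp
      ultimately show ?thesis unfolding group by simp
    qed
    show "w = id" if w: "w \<in> perm_group AffSym n"
      and inc: "\<And>x y. x \<in> UNIV \<and> y \<in> UNIV \<and> y = x + 1 \<Longrightarrow> w x < w y" for w
    proof -
      have *: "w x = w 0 + x" for x using increasing_bij_int[of w x] w inc by simp
      have "w x - x = w 0" for x using *[of x] by simp
      then have "(\<Sum>i = 1..?N. w 0) = 0" using w unfolding group by simp
      then have "w 0 = 0" using assms by simp
      then have "w x = id x" for x using *[of x] by simp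
      then show ?thesis ..
    qed
    show "id \<in> perm_group AffSym n" unfolding group by simp
    show "w (g x) = g (w x)" if "w \<in> perm_group AffSym n" "g \<in> symmetries ?N False" for w g x
      using symmetryE[OF that(2)] translation[OF that(1)] by auto
    show "x = y" if "w \<in> perm_group AffSym n" "w x = w y" for w x y
      using that bij_is_inj[of w] by (auto dest: injD)
    show "(\<Sum>x = 1..?N. h (gen AffSym n a x)) = (\<Sum>x = 1..?N. h x)"
      if "\<And>g x. g \<in> symmetries ?N False \<Longrightarrow> h (g x) = h x"
      for a and h :: "int \<Rightarrow> int"
      by (rule window[of h]) (rule that[OF symmetries_translation[OF dvd_refl]])
    show "\<exists>g\<in>symmetries ?N False. g x \<in> {1..?N}" for x
    proof -
      obtain c where "?N dvd c" "x + c \<in> {1..?N}" using window_representative[of ?N x] assms by auto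
      then show ?thesis by (intro bexI[OF _ symmetries_translation]) auto
    qed
    show "\<exists>g\<in>symmetries ?N False. x = g (int a) \<or> x = g (int a + 1)"
      if "gen AffSym n a x \<noteq> x" for a x
    proof -
      have "?N dvd x - int a \<or> ?N dvd x - (int a + 1)"
        using that by (simp add: periodic_swap_def split: if_splits)
      then show ?thesis
        using bexI[OF _ symmetries_translation[of ?N "x - int a" False]]
          bexI[OF _ symmetries_translation[of ?N "x - (int a + 1)" False]] by fastforce
    qed
    show "gen AffSym n a (int a) = int a + 1" for a by (simp add: periodic_swap_def)
    then show "gen AffSym n a (int a + 1) = int a" for a using gen_invol by metis
    show "\<exists>a\<in>letters AffSym n. gen AffSym n a x = y"
      if "x \<in> UNIV \<and> y \<in> UNIV \<and> y = x + 1" for x y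
      using that gen_dvd[OF dvd_mod(1)[of x]] dvd_mod(2)[of x]
      by (intro bexI[of _ "nat (x mod ?N)"]) (simp_all del: gen.simps)
    show "\<exists>a\<in>letters AffSym n. \<exists>b\<in>letters AffSym n. gen AffSym n a x = y \<and> gen AffSym n b y = z \<and>
        (braid_letters n a b \<or> braid_letters n b a)"
      if "x \<in> UNIV \<and> y \<in> UNIV \<and> y = x + 1" "y \<in> UNIV \<and> z \<in> UNIV \<and> z = y + 1" for x y z
    proof -
      \<comment> \<open>The second letter is \<open>a + 1\<close> without reduction modulo
        \<open>n\<close>, so after \<open>n - 1\<close> comes \<open>n\<close> and not
        \<open>0\<close>, and the letters stay adjacent numbers. The repeated letter is
        \<open>a\<close>, or \<open>a + 1 = 1\<close> if \<open>a = 0\<close>.\<close>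
      define a where "a = nat (x mod ?N)"
      have a: "a \<in> letters AffSym n" "a + 1 \<in> letters AffSym n" "?N dvd x - int a"
        "?N dvd y - int (a + 1)" "a < n"
        using dvd_mod[of x] that by (auto simp: a_def)
      moreover have "braid_letters n a (a + 1) \<or> braid_letters n (a + 1) a"
        using assms \<open>a < n\<close> by (cases "a = 0") (auto simp: braid_letters_def)
      moreover have "gen AffSym n a x = y" "gen AffSym n (a + 1) y = z"
        using gen_dvd[OF a(3)] gen_dvd[OF a(4)] that by simp_all
      ultimately show ?thesis by blast
    qed
    show "\<exists>a\<in>letters AffSym n. \<exists>b\<in>letters AffSym n. gen AffSym n a x = y \<and> gen AffSym n b y = z \<and>
        gen AffSym n a z = t \<and> gen AffSym n b x = x \<and> braid_letters n a b"
      if "x \<in> UNIV \<and> y \<in> UNIV \<and> y = x + 1" "y \<in> UNIV \<and> z \<in> UNIV \<and> z = y + 1"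
        "z \<in> UNIV \<and> t \<in> UNIV \<and> t = z + 1" "gen AffSym n c x = y" "gen AffSym n c z = t"
      for x y z t c
    proof -
      \<comment> \<open>Vacuous case: \<open>x\<close> and \<open>z = x + 2\<close> would be
        congruent modulo \<open>n\<close>.\<close>
      have "?N dvd x - int c" "?N dvd z - int c" using up that by metis+
      then have "?N dvd (z - int c) - (x - int c)" by (rule dvd_diff[rotated])
      then have False using not_dvd(2) that by simp
      then show ?thesis ..
    qed
  qed simp_all
qed

section \<open>Generators and letters of the affine group with reflections\<close>

lemma dvd_uminus_diff: "N dvd - x - c \<longleftrightarrow> N dvd x + c" for N :: int
  using dvd_minus_iff[of N "x + c"] by simp

lemma gen_AffSymC_0:
  "gen AffSymC n 0 x = (if 2 * (int n + 1) dvd x + 1 then x + 2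
    else if 2 * (int n + 1) dvd x - 1 then x - 2 else x)"
  by (simp add: periodic_swap_def)

lemma gen_AffSymC_n:
  assumes "0 < n"
  shows "gen AffSymC n n x = (if 2 * (int n + 1) dvd x - int n then x + 2
    else if 2 * (int n + 1) dvd x - (int n + 2) then x - 2 else x)"
  using assms by (simp add: periodic_swap_def Let_def)

text \<open>For \<open>0 < a < n\<close> the residues of \<open>a\<close>, \<open>a + 1\<close>,
  \<open>- a\<close> and \<open>- (a + 1)\<close> modulo \<open>2 * (n + 1)\<close> are distinct, so
  the two periodic swaps do not interfere.\<close>

lemma gen_AffSymC_mid:
  assumes "0 < a" "a < n"
  shows "gen AffSymC n a x = (if 2 * (int n + 1) dvd x - int a then x + 1
    else if 2 * (int n + 1) dvd x - (int a + 1) then x - 1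
    else if 2 * (int n + 1) dvd x + int a then x - 1
    else if 2 * (int n + 1) dvd x + (int a + 1) then x + 1 else x)"
proof -
  let ?N = "2 * (int n + 1)" and ?a = "int a"
  have eq: "gen AffSymC n a x = periodic_swap ?N ?a (?a + 1) (periodic_swap ?N (- ?a) (- (?a + 1)) x)"
    using assms by (simp add: Let_def)
  have close: "u = v" if "?N dvd u" "?N dvd v" "\<bar>u - v\<bar> < ?N" for u v using dvd_close[OF that] .
  consider (neg) "?N dvd x + ?a" | (neg1) "\<not> ?N dvd x + ?a" "?N dvd x + (?a + 1)"
    | (pos) "\<not> ?N dvd x + ?a" "\<not> ?N dvd x + (?a + 1)" by blast
  then show ?thesis
  proof cases
    case neg
    have "\<not> ?N dvd x - ?a" "\<not> ?N dvd x - (?a + 1)" "\<not> ?N dvd x - 1 - ?a" "\<not> ?N dvd x - 1 - (?a + 1)"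
      using close[OF neg, of "x - ?a"] close[OF neg, of "x - (?a + 1)"]
        close[OF neg, of "x - 1 - ?a"] close[OF neg, of "x - 1 - (?a + 1)"] assms by auto
    moreover have "periodic_swap ?N (- ?a) (- (?a + 1)) x = x - 1" using neg by (simp add: periodic_swap_def)
    ultimately show ?thesis using neg unfolding eq by (simp add: periodic_swap_def)
  next
    case neg1
    have "\<not> ?N dvd x - ?a" "\<not> ?N dvd x - (?a + 1)" "\<not> ?N dvd x + 1 - ?a" "\<not> ?N dvd x + 1 - (?a + 1)"
      using close[OF neg1(2), of "x - ?a"] close[OF neg1(2), of "x - (?a + 1)"]
        close[OF neg1(2), of "x + 1 - ?a"] close[OF neg1(2), of "x + 1 - (?a + 1)"] assms by auto
    moreover have "periodic_swap ?N (- ?a) (- (?a + 1)) x = x + 1"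
      using neg1 by (simp add: periodic_swap_def algebra_simps)
    ultimately show ?thesis using neg1 unfolding eq by (simp add: periodic_swap_def)
  next
    case pos
    then have "periodic_swap ?N (- ?a) (- (?a + 1)) x = x"
      by (simp add: periodic_swap_def algebra_simps)
    then show ?thesis using pos unfolding eq by (simp add: periodic_swap_def)
  qed
qed

lemma gen_AffSymC_shift:
  assumes "2 * (int n + 1) dvd c"
  shows "gen AffSymC n a (x + c) = gen AffSymC n a x + c"
  using periodic_swap_shift[OF assms] by (simp add: Let_def)

lemma gen_AffSymC_odd:
  assumes "2 \<le> n" "a \<le> n"
  shows "gen AffSymC n a (- x) = - gen AffSymC n a x"
proof -
  let ?N = "2 * (int n + 1)"
  have close: "u = v" if "?N dvd u" "?N dvd v" "\<bar>u - v\<bar> < ?N" for u v using dvd_close[OF that] .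
  consider "a = 0" | "a = n" "0 < n" | "0 < a" "a < n" using assms by linarith
  then show ?thesis
  proof cases
    case 1
    then show ?thesis using close[of "x + 1" "x - 1"] dvd_diff_commute[of ?N 1 x] assms
      by (auto simp: gen_AffSymC_0 dvd_uminus_diff simp del: gen.simps)
  next
    case 2
    \<comment> \<open>Since \<open>n + (n + 2) = ?N\<close>, negation exchanges the residue classes
      of \<open>n\<close> and \<open>n + 2\<close>.\<close>
    have "?N dvd x + int n \<longleftrightarrow> ?N dvd x - (int n + 2)"
      using dvd_add_left_iff[of ?N ?N "x - (int n + 2)"] by (simp add: algebra_simps)
    moreover have "?N dvd x + (int n + 2) \<longleftrightarrow> ?N dvd x - int n"
      using dvd_add_left_iff[of ?N ?N "x - int n"] by (simp add: algebra_simps)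
    ultimately show ?thesis using 2 close[of "x - int n" "x - (int n + 2)"] assms
      by (auto simp: gen_AffSymC_n dvd_uminus_diff simp del: gen.simps)
  next
    case 3
    then show ?thesis
      using close[of "x - int a" "x - (int a + 1)"] close[of "x - int a" "x + int a"]
        close[of "x - int a" "x + (int a + 1)"] close[of "x - (int a + 1)" "x + int a"]
        close[of "x - (int a + 1)" "x + (int a + 1)"] close[of "x + int a" "x + (int a + 1)"]
        dvd_diff_commute[of ?N "int a" x] dvd_diff_commute[of ?N "int a + 1" x]
      by (auto simp: gen_AffSymC_mid dvd_uminus_diff simp del: gen.simps)
  qed
qed

lemma bij_gen_AffSymC:
  assumes "2 \<le> n"
  shows "bij (gen AffSymC n a)"
proof -
  have "\<not> 2 * (int n + 1) dvd d" if "\<bar>d\<bar> < 3" "d \<noteq> 0" for d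
    using dvd_close[of "2 * (int n + 1)" d 0] that assms by auto
  then have "bij (periodic_swap (2 * (int n + 1)) x y)" if "\<bar>y - x\<bar> < 3" "x \<noteq> y" for x y
    using bij_periodic_swap that by simp
  then show ?thesis by (auto simp: Let_def intro!: bij_comp)
qed

text \<open>The letter of the generator that exchanges \<open>x\<close> with the next unfrozen integer.\<close>

definition label_AffSymC :: "nat \<Rightarrow> int \<Rightarrow> nat \<Rightarrow> bool" where
  "label_AffSymC n x a \<longleftrightarrow> 0 < a \<and> a \<le> n \<and> 2 * (int n + 1) dvd x - int a \<or>
    a < n \<and> 2 * (int n + 1) dvd x + int a + 1"

definition next_AffSymC :: "nat \<Rightarrow> int \<Rightarrow> int" where
  "next_AffSymC n x = (if int n + 1 dvd x + 1 then x + 2 else x + 1)"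

lemma next_AffSymC_up:
  assumes "0 < a" "a \<le> n" "2 * (int n + 1) dvd x - int a"
  shows "next_AffSymC n x = (if a = n then x + 2 else x + 1)"
proof -
  have "int n + 1 dvd x - int a" using assms(3) by (rule dvd_mult_right)
  then have "int n + 1 dvd x + 1 \<longleftrightarrow> int n + 1 dvd int a + 1"
    using dvd_add_right_iff[of "int n + 1" "x - int a" "int a + 1"] by (simp add: algebra_simps)
  also have "\<dots> \<longleftrightarrow> a = n"
    using dvd_close[of "int n + 1" "int a + 1" "int n + 1"] assms by auto
  finally show ?thesis by (simp add: next_AffSymC_def)
qed

lemma next_AffSymC_down:
  assumes "a < n" "2 * (int n + 1) dvd x + int a + 1"
  shows "next_AffSymC n x = (if a = 0 then x + 2 else x + 1)"
proof -
  have "int n + 1 dvd x + int a + 1" using assms(2) by (rule dvd_mult_right)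
  then have "int n + 1 dvd x + 1 \<longleftrightarrow> int n + 1 dvd - int a"
    using dvd_add_right_iff[of "int n + 1" "x + int a + 1" "- int a"] by (simp add: algebra_simps)
  also have "\<dots> \<longleftrightarrow> a = 0"
    using dvd_close[of "int n + 1" "- int a" 0] assms by auto
  finally show ?thesis by (simp add: next_AffSymC_def)
qed

text \<open>The residue \<open>q\<close> of an unfrozen integer is neither \<open>0\<close> nor
  \<open>n + 1\<close>. Below \<open>n + 1\<close> it is itself the letter; above, the letter is
  that of the mirrored pair.\<close>

lemma label_AffSymC_exists:
  assumes "\<not> int n + 1 dvd x"
  shows "\<exists>a. label_AffSymC n x a"
proof -
  let ?N = "2 * (int n + 1)"
  define q where "q = x mod ?N"
  have q: "0 \<le> q" "q < ?N" "?N dvd x - q" by (simp_all add: q_def)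
  then have "int n + 1 dvd x - q" using dvd_mult_right by blast
  then have "q \<noteq> 0" "q \<noteq> int n + 1"
    using assms dvd_add_left_iff[of "int n + 1" "int n + 1" "x - (int n + 1)"] by auto
  then consider "0 < q" "q \<le> int n" | "int n + 1 < q" using q by linarith
  then show ?thesis
  proof cases
    case 1
    then show ?thesis using q by (intro exI[of _ "nat q"]) (simp add: label_AffSymC_def nat_le_iff)
  next
    case 2
    have "?N dvd (x - q) + ?N" using q(3) by simp
    then show ?thesis using 2 q
      by (intro exI[of _ "nat (?N - 1 - q)"]) (simp add: label_AffSymC_def nat_less_iff algebra_simps)
  qed
qed

lemma gen_label_AffSymC:
  assumes "label_AffSymC n x a"
  shows "a \<le> n" "gen AffSymC n a x = next_AffSymC n x"
proof -
  let ?N = "2 * (int n + 1)"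
  show "a \<le> n" using assms by (auto simp: label_AffSymC_def)
  consider (up) "0 < a" "a \<le> n" "?N dvd x - int a" | (down) "a < n" "?N dvd x + int a + 1"
    using assms by (auto simp: label_AffSymC_def)
  then show "gen AffSymC n a x = next_AffSymC n x"
  proof cases
    case up
    then show ?thesis unfolding next_AffSymC_up[OF up]
      by (cases "a = n") (simp_all add: gen_AffSymC_n gen_AffSymC_mid del: gen.simps)
  next
    case down
    have "\<not> ?N dvd x - int a" "\<not> ?N dvd x - (int a + 1)" "\<not> ?N dvd x + int a"
      using dvd_close[OF down(2), of "x - int a"] dvd_close[OF down(2), of "x - (int a + 1)"]
        dvd_close[OF down(2), of "x + int a"] down(1) by auto
    then show ?thesis using down(2) unfolding next_AffSymC_down[OF down]
      using down(1) by (cases "a = 0")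
        (simp_all add: gen_AffSymC_0 gen_AffSymC_mid add.assoc del: gen.simps)
  qed
qed

text \<open>Along a period the letters run \<open>1, 2, ..., n, n - 1, ..., 1, 0\<close> and start
  again, so neighbours in this sequence differ by one. As \<open>n \<ge> 2\<close>, the letters next
  to the turns \<open>n\<close> and \<open>0\<close> lie in \<open>[n - 1]\<close>.\<close>

lemma label_AffSymC_next:
  assumes "2 \<le> n" "label_AffSymC n x a"
  shows "\<exists>b. label_AffSymC n (next_AffSymC n x) b \<and> (braid_letters n a b \<or> braid_letters n b a)"
proof -
  let ?N = "2 * (int n + 1)"
  consider (up) "0 < a" "a \<le> n" "?N dvd x - int a" | (down) "a < n" "?N dvd x + int a + 1"
    using assms(2) by (auto simp: label_AffSymC_def)
  then show ?thesis
  proof cases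
    case up
    show ?thesis
    proof (cases "a = n")
      case True
      have "?N dvd (x - int a) + ?N" using up(3) by simp
      then have "?N dvd x + 2 + int (n - 1) + 1" using True assms(1) by (simp add: of_nat_diff algebra_simps)
      then show ?thesis unfolding next_AffSymC_up[OF up] using True assms(1)
        by (intro exI[of _ "n - 1"]) (auto simp: label_AffSymC_def braid_letters_def)
    next
      case False
      then show ?thesis unfolding next_AffSymC_up[OF up] using up
        by (intro exI[of _ "a + 1"]) (auto simp: label_AffSymC_def braid_letters_def)
    qed
  next
    case down
    show ?thesis
    proof (cases "a = 0")
      case True
      then show ?thesis unfolding next_AffSymC_down[OF down] using down assms(1)
        by (intro exI[of _ 1]) (auto simp: label_AffSymC_def braid_letters_def algebra_simps)
    next
      case False
      then have "?N dvd x + 1 + int (a - 1) + 1" using down(2) by (simp add: of_nat_diff algebra_simps)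
      then show ?thesis unfolding next_AffSymC_down[OF down] using down False
        by (intro exI[of _ "a - 1"]) (auto simp: label_AffSymC_def braid_letters_def)
    qed
  qed
qed

text \<open>A generator raises only points that carry its letter. This translates the hypotheses of
  \<open>braid4\<close>, which speak of a given generator, into statements about letters.\<close>

lemma label_AffSymC_if_gen:
  assumes "2 \<le> n" "a \<le> n" "gen AffSymC n a x = next_AffSymC n x"
  shows "label_AffSymC n x a"
proof -
  have less: "x < gen AffSymC n a x" using assms(3) by (simp add: next_AffSymC_def)
  consider "a = 0" | "a = n" "0 < n" | "0 < a" "a < n" using assms by linarith
  then show ?thesis
  proof cases
    case 1
    then show ?thesis using less assms(1)
      by (auto simp: gen_AffSymC_0 label_AffSymC_def simp del: gen.simps split: if_splits)
  next
    case 2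
    then show ?thesis using less assms(1)
      by (auto simp: gen_AffSymC_n label_AffSymC_def simp del: gen.simps split: if_splits)
  next
    case 3
    then show ?thesis using less
      by (auto simp: gen_AffSymC_mid label_AffSymC_def add.assoc simp del: gen.simps split: if_splits)
  qed
qed

text \<open>In the periodic sequence of letters a letter returns after two steps only around a turn,
  as \<open>n - 1, n, n - 1\<close> or \<open>1, 0, 1\<close>.\<close>

lemma label_AffSymC_repeated:
  assumes "2 \<le> n" "label_AffSymC n x a" "label_AffSymC n (next_AffSymC n (next_AffSymC n x)) a"
  shows "\<exists>b. label_AffSymC n (next_AffSymC n x) b \<and> gen AffSymC n b x = x \<and> braid_letters n a b"
proof -
  let ?N = "2 * (int n + 1)" and ?y = "next_AffSymC n x"
  have no: "\<not> ?N dvd v" if "?N dvd u" "u \<noteq> v" "\<bar>u - v\<bar> < ?N" for u v using dvd_close that by blast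
  consider (up) "0 < a" "a \<le> n" "?N dvd x - int a" | (down) "a < n" "?N dvd x + int a + 1"
    using assms(2) by (auto simp: label_AffSymC_def)
  then show ?thesis
  proof cases
    case up
    show ?thesis
    proof (cases "a = n")
      case True
      then have y: "?y = x + 2" using next_AffSymC_up[OF up] by simp
      have "?N dvd (x - int a) + ?N" using up(3) by simp
      then have "?N dvd (x + 2) + int (n - 1) + 1" using True assms(1) by (simp add: of_nat_diff algebra_simps)
      then have "next_AffSymC n ?y = x + 3" using next_AffSymC_down[of "n - 1" n "x + 2"] y assms(1) by simp
      then show ?thesis using assms True no[OF up(3), of "x + 3 - int a"] by (simp add: label_AffSymC_def)
    next
      case False
      then have y: "?y = x + 1" using next_AffSymC_up[OF up] by simp
      have up': "0 < a + 1" "a + 1 \<le> n" "?N dvd ?y - int (a + 1)" using up y False by simp_all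
      have "a + 1 = n"
      proof (rule ccontr)
        assume "a + 1 \<noteq> n"
        then have "next_AffSymC n ?y = x + 2" using next_AffSymC_up[OF up'] y by simp
        moreover have "\<not> ?N dvd x + 2 - int a" using no[OF up(3)] assms(1) by simp
        moreover have "\<not> ?N dvd x + 2 + int a + 1"
          using no[OF up(3), of "x + 2 + int a + 1"] up(2) False \<open>a + 1 \<noteq> n\<close> by simp
        ultimately show False using assms(3) by (simp add: label_AffSymC_def)
      qed
      moreover have "gen AffSymC n n x = x"
        using no[OF up(3), of "x - int n"] no[OF up(3), of "x - (int n + 2)"] \<open>a + 1 = n\<close> assms(1)
        by (auto simp: gen_AffSymC_n simp del: gen.simps)
      ultimately show ?thesis using up' up(1)
        by (intro exI[of _ n]) (auto simp: label_AffSymC_def braid_letters_def simp del: gen.simps)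
    qed
  next
    case down
    show ?thesis
    proof (cases "a = 0")
      case True
      then have y: "?y = x + 2" using next_AffSymC_down[OF down] by simp
      have "?N dvd x + 2 - int 1" using down(2) True by (simp add: algebra_simps)
      then have "next_AffSymC n ?y = x + 3" using next_AffSymC_up[of 1 n "x + 2"] y assms(1) by simp
      then show ?thesis using assms True no[OF down(2), of "x + 3 + int a + 1"] by (simp add: label_AffSymC_def)
    next
      case False
      then have y: "?y = x + 1" using next_AffSymC_down[OF down] by simp
      have down': "a - 1 < n" "?N dvd ?y + int (a - 1) + 1"
        using down y False by (simp_all add: of_nat_diff algebra_simps)
      have "a = 1"
      proof (rule ccontr)
        assume "a \<noteq> 1"
        then have "next_AffSymC n ?y = x + 2" using next_AffSymC_down[OF down'] y False by simp
        moreover have "\<not> ?N dvd x + 2 - int a"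
          using no[OF down(2), of "x + 2 - int a"] down(1) False \<open>a \<noteq> 1\<close> by simp
        moreover have "\<not> ?N dvd x + 2 + int a + 1"
          using no[OF down(2), of "x + 2 + int a + 1"] assms(1) by simp
        ultimately show False using assms(3) by (simp add: label_AffSymC_def)
      qed
      moreover have "gen AffSymC n 0 x = x"
        using no[OF down(2), of "x + 1"] no[OF down(2), of "x - 1"] \<open>a = 1\<close> assms(1)
        by (auto simp: gen_AffSymC_0 simp del: gen.simps)
      ultimately show ?thesis using down' assms(1)
        by (intro exI[of _ 0]) (auto simp: label_AffSymC_def braid_letters_def simp del: gen.simps)
    qed
  qed
qed

lemma window_group_AffSymC:
  assumes "2 \<le> n"
  shows "window_group AffSymC n (2 * (int n + 1)) True {1..2 * (int n + 1)}
    (\<lambda>a. if a = 0 then - 1 else int a)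
    (\<lambda>a. if a = 0 then 1 else if a = n then int n + 2 else int a + 1)"
proof -
  let ?M = "int n + 1" and ?N = "2 * (int n + 1)" and ?next = "next_AffSymC n"
  let ?U = "{i. \<not> int n + 1 dvd i}"
  have not_dvd: "\<not> ?M dvd d" if "0 < \<bar>d\<bar>" "\<bar>d\<bar> < ?M" for d
    using dvd_close[of ?M d 0] that by auto
  have nb: "neighbours ?U x y \<longleftrightarrow> x \<in> ?U \<and> y \<in> ?U \<and> y = ?next x" for x y
  proof (rule neighbours_iff_next)
    show "x < ?next x" for x by (simp add: next_AffSymC_def)
    fix x y assume xy: "x \<in> ?U" "y \<in> ?U" "x < y"
    have "\<not> ?M dvd x + 2" if "?M dvd x + 1"
      using dvd_add_right_iff[OF that, of 1] not_dvd[of 1] assms by (simp add: algebra_simps)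
    moreover have "x + 2 \<le> y" if "?M dvd x + 1"
      using that xy by (cases "y = x + 1") auto
    ultimately show "?next x \<in> ?U \<and> ?next x \<le> y" using xy(3) by (simp add: next_AffSymC_def)
  qed
  have odd: "w (- x) = - w x" if "w \<in> perm_group AffSymC n" for w x
    using that by simp
  have translation: "w (x + c) = w x + c" if w: "w \<in> perm_group AffSymC n" "?N dvd c" for w x c
  proof (rule equivariant_shift[OF _ w(2)])
    fix x
    have "w (x + ?N) = w (?N - - x)" by (rule arg_cong[of _ _ w]) simp
    also have "\<dots> = ?N - w (- x)" using w(1) unfolding perm_group.simps by blast
    also have "\<dots> = w x + ?N" unfolding odd[OF w(1)] by simp
    finally show "w (x + ?N) = w x + ?N" .
  qed
  have symmetry: "w (g x) = g (w x)" if w: "w \<in> perm_group AffSymC n" "g \<in> symmetries ?N True" for w g x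
    using w(2)
  proof (cases rule: symmetries_cases)
    case (reflection c)
    have "w (c - x) = w (- x + c)" by simp
    also have "\<dots> = c - w x" unfolding translation[OF w(1) reflection(2)] odd[OF w(1)] by simp
    finally show ?thesis by (simp add: reflection(3))
  qed (simp add: translation[OF w(1)])
  have inj: "x = y" if "w \<in> perm_group AffSymC n" "w x = w y" for w x y
    using that bij_is_inj[of w] by (auto dest: injD)
  have frozen: "w x = x" if w: "w \<in> perm_group AffSymC n" and "?M dvd x" for w x
  proof -
    \<comment> \<open>The reflection about a multiple \<open>x\<close> of \<open>n + 1\<close> is a
      symmetry, hence \<open>w x = 2 * x - w x\<close>.\<close>
    have "?N dvd 2 * x" using that(2) by (rule mult_dvd_mono[OF dvd_refl])
    from symmetry[OF w symmetries_reflection[OF this], of x] show ?thesis by simp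
  qed
  have window: "(\<Sum>x = 1..?N. h (gen AffSymC n a x)) = (\<Sum>x = 1..?N. h x)"
    if "\<And>x. h (x + ?N) = h x" for a and h :: "int \<Rightarrow> int"
    by (rule sum_window_periodic)
      (use that bij_is_inj[OF bij_gen_AffSymC[OF assms]] gen_AffSymC_shift[OF dvd_refl]
        in \<open>simp_all del: gen.simps\<close>)
  have label: "\<exists>a. label_AffSymC n x a" if "x \<in> ?U" for x
    using label_AffSymC_exists that by simp
  show ?thesis
  proof (unfold_locales, unfold unfrozen.simps nb)
    show "w \<circ> gen AffSymC n a \<in> perm_group AffSymC n"
      if w: "w \<in> perm_group AffSymC n" and a: "a \<in> letters AffSymC n" for w a
    proof -
      let ?s = "gen AffSymC n a"
      have s_odd: "?s (- x) = - ?s x" for x using gen_AffSymC_odd[OF assms] a by simp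
      have "?s (?N - i) = ?N - ?s i" for i
        using gen_AffSymC_shift[OF dvd_refl, of n a "- i"] s_odd by (simp del: gen.simps)
      moreover have "w (?N - i) = ?N - w i" for i using w by simp
      moreover have "bij w" using w by simp
      then have "bij (w \<circ> ?s)" by (rule bij_comp[OF bij_gen_AffSymC[OF assms]])
      ultimately show ?thesis using s_odd odd[OF w] by (simp del: gen.simps)
    qed
    show "w = id" if w: "w \<in> perm_group AffSymC n"
      and inc: "\<And>x y. x \<in> ?U \<and> y \<in> ?U \<and> y = ?next x \<Longrightarrow> w x < w y" for w
    proof -
      have jump: "w (z - 1) < z \<and> z < w (z + 1)" if z: "?M dvd z" for z
      proof -
        have "\<not> ?M dvd z - 1" "\<not> ?M dvd z + 1"
          using dvd_add_right_iff[OF z, of "- 1"] dvd_add_right_iff[OF z, of 1] not_dvd[of 1] assms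
          by simp_all
        then have "w (z - 1) < w (z + 1)"
          using inc[of "z - 1" "z + 1"] z by (simp add: next_AffSymC_def)
        moreover have "?N dvd 2 * z" using z by (rule mult_dvd_mono[OF dvd_refl])
        from symmetry[OF w symmetries_reflection[OF this], of "z - 1"]
        have "w (z + 1) = 2 * z - w (z - 1)" by simp
        ultimately show ?thesis by simp
      qed
      have "w x < w (x + 1)" for x
      proof -
        consider "?M dvd x" | "?M dvd x + 1" | "\<not> ?M dvd x" "\<not> ?M dvd x + 1" by blast
        then show ?thesis
        proof cases
          case 1
          then show ?thesis using jump[of x] frozen[OF w, of x] by simp
        next
          case 2
          then show ?thesis using jump[of "x + 1"] frozen[OF w, of "x + 1"] by simp
        next
          case 3
          then show ?thesis using inc[of x "x + 1"] by (simp add: next_AffSymC_def)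
        qed
      qed
      then have *: "w x = w 0 + x" for x using increasing_bij_int[of w x] w by simp
      have "w x = id x" for x using *[of x] frozen[OF w, of 0] by simp
      then show ?thesis ..
    qed
    show "id \<in> perm_group AffSymC n" by simp
    show "w (g x) = g (w x)" if "w \<in> perm_group AffSymC n" "g \<in> symmetries ?N True" for w g x
      using symmetry[OF that] .
    show "g x \<in> ?U" if g: "g \<in> symmetries ?N True" and x: "x \<in> ?U" for g x
      using g
    proof (cases rule: symmetries_cases)
      case (translation c)
      have "?M dvd c" using translation(1) by (rule dvd_mult_right)
      then show ?thesis using x dvd_add_left_iff[of ?M c x] by (simp add: translation(2))
    next
      case (reflection c)
      have "?M dvd c" using reflection(2) by (rule dvd_mult_right)
      then show ?thesis using x dvd_add_right_iff[of ?M c "- x"] by (simp add: reflection(3))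
    qed
    show "x = y" if "w \<in> perm_group AffSymC n" "w x = w y" for w x y
      using inj[OF that] .
    show "w x \<in> ?U" if w: "w \<in> perm_group AffSymC n" and x: "x \<in> ?U" for w x
      \<comment> \<open>If \<open>w x\<close> were frozen, it would be fixed by \<open>w\<close>,
        and injectivity would give \<open>w x = x\<close>.\<close>
      using frozen[OF w, of "w x"] inj[OF w, of "w x" x] x by auto
    show "(\<Sum>x = 1..?N. h (gen AffSymC n a x)) = (\<Sum>x = 1..?N. h x)"
      if "\<And>g x. g \<in> symmetries ?N True \<Longrightarrow> h (g x) = h x"
      for a and h :: "int \<Rightarrow> int"
      by (rule window[of h]) (rule that[OF symmetries_translation[OF dvd_refl]])
    show "\<exists>g\<in>symmetries ?N True. g x \<in> {1..?N}" for x
    proof -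
      obtain c where "?N dvd c" "x + c \<in> {1..?N}" using window_representative[of ?N x] by auto
      then show ?thesis by (intro bexI[OF _ symmetries_translation]) auto
    qed
    fix a assume a: "a \<in> letters AffSymC n"
    let ?lo = "if a = 0 then - 1 else int a"
      and ?hi = "if a = 0 then 1 else if a = n then int n + 2 else int a + 1"
    have lab: "label_AffSymC n ?lo a" using a assms by (simp add: label_AffSymC_def)
    have next_lo: "?next ?lo = ?hi"
      using next_AffSymC_up[of a n "int a"] next_AffSymC_down[of 0 n "- 1"] a assms by auto
    show gen_lo: "gen AffSymC n a ?lo = ?hi"
      using gen_label_AffSymC(2)[OF lab] next_lo by simp
    have "\<not> ?N dvd 1" "\<not> ?N dvd 2"
      using dvd_close[of ?N 1 0] dvd_close[of ?N 2 0] assms by auto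
    then show "gen AffSymC n a ?hi = ?lo"
      using a assms by (simp add: gen_AffSymC_0 gen_AffSymC_n gen_AffSymC_mid del: gen.simps)
    have "?hi \<in> ?U"
      using not_dvd[of 1] not_dvd[of "int a + 1"] dvd_add_right_iff[of ?M ?M 1] a assms
      by (auto simp: algebra_simps)
    moreover have "?lo \<in> ?U" using not_dvd[of "- 1"] not_dvd[of "int a"] a assms by auto
    ultimately show "?lo \<in> ?U \<and> ?hi \<in> ?U \<and> ?hi = ?next ?lo" using next_lo by simp
    show "\<exists>g\<in>symmetries ?N True. x = g ?lo \<or> x = g ?hi" if moved: "gen AffSymC n a x \<noteq> x" for x
    proof -
      \<comment> \<open>The four alternatives say which of the two points is mapped to
        \<open>x\<close>, and whether by a translation or by a reflection.\<close>
      have "?N dvd x - ?lo \<or> ?N dvd x - ?hi \<or> ?N dvd x + ?lo \<or> ?N dvd x + ?hi"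
        using moved a assms
        by (cases "a = 0"; cases "a = n")
          (auto simp: gen_AffSymC_0 gen_AffSymC_n gen_AffSymC_mid simp del: gen.simps split: if_splits)
      then show ?thesis
        using bexI[OF _ symmetries_translation[of ?N "x - ?lo" True], of "\<lambda>g. x = g ?lo \<or> x = g ?hi"]
          bexI[OF _ symmetries_translation[of ?N "x - ?hi" True], of "\<lambda>g. x = g ?lo \<or> x = g ?hi"]
          bexI[OF _ symmetries_reflection[of ?N "x + ?lo" True], of "\<lambda>g. x = g ?lo \<or> x = g ?hi"]
          bexI[OF _ symmetries_reflection[of ?N "x + ?hi" True], of "\<lambda>g. x = g ?lo \<or> x = g ?hi"]
        by (elim disjE) simp_all
    qed
  next
    show "\<exists>a\<in>letters AffSymC n. gen AffSymC n a x = y" if "x \<in> ?U \<and> y \<in> ?U \<and> y = ?next x" for x y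
      using label[of x] gen_label_AffSymC that by fastforce
    show "\<exists>a\<in>letters AffSymC n. \<exists>b\<in>letters AffSymC n. gen AffSymC n a x = y \<and> gen AffSymC n b y = z \<and>
        (braid_letters n a b \<or> braid_letters n b a)"
      if "x \<in> ?U \<and> y \<in> ?U \<and> y = ?next x" "y \<in> ?U \<and> z \<in> ?U \<and> z = ?next y" for x y z
    proof -
      from label[of x] that(1) obtain a where a: "label_AffSymC n x a" by blast
      from label_AffSymC_next[OF assms a] that(1)
      obtain b where b: "label_AffSymC n y b" "braid_letters n a b \<or> braid_letters n b a" by blast
      show ?thesis
        using gen_label_AffSymC[OF a] gen_label_AffSymC[OF b(1)] b(2) that
        by (intro bexI[of _ a] bexI[of _ b]) (simp_all del: gen.simps)
    qed
    show "\<exists>a\<in>letters AffSymC n. \<exists>b\<in>letters AffSymC n. gen AffSymC n a x = y \<and> gen AffSymC n b y = z \<and>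
        gen AffSymC n a z = t \<and> gen AffSymC n b x = x \<and> braid_letters n a b"
      if "x \<in> ?U \<and> y \<in> ?U \<and> y = ?next x" "y \<in> ?U \<and> z \<in> ?U \<and> z = ?next y"
        "z \<in> ?U \<and> t \<in> ?U \<and> t = ?next z"
        "a \<in> letters AffSymC n" "gen AffSymC n a x = y" "gen AffSymC n a z = t" for x y z t a
    proof -
      have "label_AffSymC n x a" "label_AffSymC n (?next (?next x)) a"
        using label_AffSymC_if_gen[OF assms, of a x] label_AffSymC_if_gen[OF assms, of a z] that
        by (simp_all del: gen.simps)
      from label_AffSymC_repeated[OF assms this] that(1)
      obtain b where b: "label_AffSymC n y b" "gen AffSymC n b x = x" "braid_letters n a b" by blast
      show ?thesis
        using gen_label_AffSymC[OF b(1)] b(2,3) that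
        by (intro bexI[of _ a] bexI[of _ b]) (simp_all del: gen.simps)
    qed
  qed simp_all
qed

theorem theorem3p3:
  fixes F :: family and n :: nat and w :: "int \<Rightarrow> int"
  assumes "n \<ge> min_window F"
    and "w \<in> perm_group F n"
    and "globally_contains_321 F n w"
  shows "\<exists>xs. reduced_word F n w xs \<and>
           (\<exists>x\<in>{1..n - 1}. sublist [x, x + 1, x] xs \<or> sublist [x, x - 1, x] xs)"
proof (cases F)
  case Sym
  then show ?thesis
    using window_group.braid_if_globally_contains_321[OF window_group_Sym] assms by blast
next
  case SymB
  then show ?thesis
    using window_group.braid_if_globally_contains_321[OF window_group_SymB] assms by blast
next
  case AffSym
  then have "3 \<le> n" using assms(1) by simp
  from window_group.braid_if_globally_contains_321[OF window_group_AffSym[OF this]]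
  show ?thesis using AffSym assms by blast
next
  case AffSymC
  then have "2 \<le> n" using assms(1) by simp
  from window_group.braid_if_globally_contains_321[OF window_group_AffSymC[OF this]]
  show ?thesis using AffSymC assms by blast
qed

end
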